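(* Assume the Ultrapower Axiom. Suppose \(U_0\) is a uniform ultrafilter and \(U_1\) is a nonprincipal uniform ultrafilter such that \(U_0\in\mathrm{Ult}(V,U_1)\) and \(P\left(2^{<\mathrm{sp}(U_0)}\right)\subseteq\mathrm{Ult}(V,U_1)\). Then \(U_0<_S U_1\).
   Context: For a countably complete ultrafilter \(U\), \(\mathrm{Ult}(V,U)\) is the transitive collapse of the ultrapower, \(j_U\) its embedding and \([\mathrm{id}]_U\) the class of the identity. A uniform ultrafilter is a countably complete ultrafilter \(U\) on \([\kappa]^n\) (the \(n\)-element subsets of an ordinal \(\kappa\)) with \(\kappa\) least such that \([\kappa]^n\in U\); \(\mathrm{sp}(U)=\kappa\). Finite sets of ordinals are ordered by \(a<b\) iff the largest element of their symmetric difference lies in \(b\). A comparison of \(\langle U_0,U_1\rangle\) by internal ultrafilters is a pair \(\langle W_0,W_1\rangle\) with \(W_i\in\mathrm{Ult}(V,U_i)\) a countably complete ultrafilter there, \(\mathrm{Ult}(\mathrm{Ult}(V,U_0),W_0)=\mathrm{Ult}(\mathrm{Ult}(V,U_1),W_1)\) and \(j_{W_0}\circ j_{U_0}=j_{W_1}\circ j_{U_1}\). The Ultrapower Axiom: every pair of countably complete ultrafilters admits such a comparison. \(U_0<_S U_1\) means there is a comparison with \(j_{W_0}([\mathrm{id}]_{U_0})<j_{W_1}([\mathrm{id}]_{U_1})\). *)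

theory Defs
  imports Main "HOL-Library.Equipollence"
begin

text \<open>
  The universe \<open>V\<close> of ZFC is a type of the following class; sets are elements of the type and
  classes are HOL sets over it.  Separation and Replacement are stated for classes and class
  functions in this sense.  The axiom of choice is not listed since it follows from
  Replacement together with Hilbert choice in HOL.
\<close>

class zfc =
  fixes elts :: "'a \<Rightarrow> 'a set"
  assumes extensionality: "elts x = elts y \<Longrightarrow> x = y"
    and foundation: "elts x \<noteq> {} \<Longrightarrow> \<exists>y\<in>elts x. elts y \<inter> elts x = {}"
    and pairing: "\<exists>z. elts z = {x, y}"
    and union: "\<exists>z. elts z = (\<Union>y\<in>elts x. elts y)"
    and powerset: "\<exists>z. elts z = {y. elts y \<subseteq> elts x}"
    and infinity: "\<exists>w. (\<exists>e\<in>elts w. elts e = {}) \<and>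
                       (\<forall>x\<in>elts w. \<exists>y\<in>elts w. elts y = insert x (elts x))"
    and separation: "\<exists>z. elts z = {y \<in> elts x. P y}"
    and replacement: "\<exists>z. elts z = F ` elts x"

text \<open>\<open>vset A\<close> is meaningful only if \<open>A\<close> is not a proper class.\<close>

definition vset :: "'v set \<Rightarrow> 'v::zfc" where
  "vset A = (THE x. elts x = A)"

definition vpow :: "'v::zfc \<Rightarrow> 'v" where
  "vpow x = vset {y. elts y \<subseteq> elts x}"

definition vpair :: "'v::zfc \<Rightarrow> 'v \<Rightarrow> 'v" where
  "vpair x y = vset {vset {x}, vset {x, y}}"

definition is_fun :: "'v::zfc \<Rightarrow> 'v \<Rightarrow> bool" where
  "is_fun f X \<longleftrightarrow> (\<forall>p\<in>elts f. \<exists>x\<in>elts X. \<exists>y. p = vpair x y) \<and>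
                 (\<forall>x\<in>elts X. \<exists>!y. vpair x y \<in> elts f)"

definition app :: "'v::zfc \<Rightarrow> 'v \<Rightarrow> 'v" where
  "app f x = (THE y. vpair x y \<in> elts f)"

definition vlam :: "'v::zfc \<Rightarrow> ('v \<Rightarrow> 'v) \<Rightarrow> 'v" where
  "vlam X F = vset ((\<lambda>x. vpair x (F x)) ` elts X)"

definition transitive :: "'v::zfc \<Rightarrow> bool" where
  "transitive x \<longleftrightarrow> (\<forall>y\<in>elts x. elts y \<subseteq> elts x)"

definition Ord :: "'v::zfc \<Rightarrow> bool" where
  "Ord x \<longleftrightarrow> transitive x \<and> (\<forall>y\<in>elts x. transitive y)"

primrec vnat :: "nat \<Rightarrow> 'v::zfc" where
  "vnat 0 = vset {}"
| "vnat (Suc n) = vset (insert (vnat n) (elts (vnat n)))"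

definition omega :: "'v::zfc" where
  "omega = vset (range vnat)"

definition vcard :: "'v::zfc \<Rightarrow> 'v" where
  "vcard x = (THE \<alpha>. Ord \<alpha> \<and> elts \<alpha> \<approx> elts x \<and> (\<forall>\<beta>\<in>elts \<alpha>. \<not> elts \<beta> \<approx> elts x))"

text \<open>The supremum of the cardinals \<open>card P(\<alpha>)\<close> for \<open>\<alpha> < \<kappa>\<close>, where \<open>\<kappa>\<close> may be any ordinal.\<close>

definition two_pow_less :: "'v::zfc \<Rightarrow> 'v" where
  "two_pow_less \<kappa> = vset (\<Union>\<alpha>\<in>elts \<kappa>. elts (vcard (vpow \<alpha>)))"

definition nsubsets :: "'v::zfc \<Rightarrow> nat \<Rightarrow> 'v" where
  "nsubsets \<kappa> n = vset {a. elts a \<subseteq> elts \<kappa> \<and> finite (elts a) \<and> card (elts a) = n}"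

text \<open>The following notions are relativized to a transitive class \<open>N\<close>, so that they apply
  both to \<open>V\<close> (\<open>N = UNIV\<close>) and to ultrapowers of \<open>V\<close>.\<close>

definition ultrafilter_on :: "'v::zfc set \<Rightarrow> 'v \<Rightarrow> 'v \<Rightarrow> bool" where
  "ultrafilter_on N U X \<longleftrightarrow>
     X \<in> N \<and> U \<in> N \<and>
     (\<forall>A\<in>elts U. elts A \<subseteq> elts X) \<and>
     X \<in> elts U \<and> vset {} \<notin> elts U \<and>
     (\<forall>A\<in>elts U. \<forall>B\<in>elts U. vset (elts A \<inter> elts B) \<in> elts U) \<and>
     (\<forall>A\<in>elts U. \<forall>B\<in>N. elts A \<subseteq> elts B \<and> elts B \<subseteq> elts X \<longrightarrow> B \<in> elts U) \<and>
     (\<forall>A\<in>N. elts A \<subseteq> elts X \<longrightarrow> A \<in> elts U \<or> vset (elts X - elts A) \<in> elts U)"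

definition cc_ultrafilter_on :: "'v::zfc set \<Rightarrow> 'v \<Rightarrow> 'v \<Rightarrow> bool" where
  "cc_ultrafilter_on N U X \<longleftrightarrow>
     ultrafilter_on N U X \<and>
     (\<forall>s\<in>N. is_fun s omega \<and> (\<forall>n\<in>elts omega. app s n \<in> elts U)
        \<longrightarrow> vset (\<Inter>n\<in>elts omega. elts (app s n)) \<in> elts U)"

definition cc_ultrafilter :: "'v::zfc set \<Rightarrow> 'v \<Rightarrow> bool" where
  "cc_ultrafilter N U \<longleftrightarrow> (\<exists>X. cc_ultrafilter_on N U X)"

text \<open>The set on which an ultrafilter lives is its largest element, hence its union.\<close>

definition base :: "'v::zfc \<Rightarrow> 'v" where
  "base U = vset (\<Union>A\<in>elts U. elts A)"

definition nonprincipal :: "'v::zfc \<Rightarrow> bool" where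
  "nonprincipal U \<longleftrightarrow> (\<forall>x\<in>elts (base U). vset {x} \<notin> elts U)"

text \<open>The Mostowski collapse of a well-founded set-like structure \<open>(A, E)\<close>; the value outside
  \<open>A\<close> is fixed only to make the function unique.\<close>

definition mostowski :: "'b set \<Rightarrow> ('b \<Rightarrow> 'b \<Rightarrow> bool) \<Rightarrow> 'b \<Rightarrow> 'v::zfc" where
  "mostowski A E = (THE \<pi>. (\<forall>a\<in>A. elts (\<pi> a) = \<pi> ` {b \<in> A. E b a}) \<and>
                           (\<forall>a. a \<notin> A \<longrightarrow> \<pi> a = undefined))"

definition ult_funs :: "'v::zfc set \<Rightarrow> 'v \<Rightarrow> 'v set" where
  "ult_funs N U = {f \<in> N. is_fun f (base U)}"

definition ult_eq :: "'v::zfc set \<Rightarrow> 'v \<Rightarrow> ('v \<times> 'v) set" where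
  "ult_eq N U = {(f, g). f \<in> ult_funs N U \<and> g \<in> ult_funs N U \<and>
                   vset {x \<in> elts (base U). app f x = app g x} \<in> elts U}"

definition ult_carrier :: "'v::zfc set \<Rightarrow> 'v \<Rightarrow> 'v set set" where
  "ult_carrier N U = ult_funs N U // ult_eq N U"

definition ult_mem :: "'v::zfc \<Rightarrow> 'v set \<Rightarrow> 'v set \<Rightarrow> bool" where
  "ult_mem U a b \<longleftrightarrow>
     (\<exists>f\<in>a. \<exists>g\<in>b. vset {x \<in> elts (base U). app f x \<in> elts (app g x)} \<in> elts U)"

definition Ult :: "'v::zfc set \<Rightarrow> 'v \<Rightarrow> 'v set" where
  "Ult N U = mostowski (ult_carrier N U) (ult_mem U) ` ult_carrier N U"

definition ult_class :: "'v::zfc set \<Rightarrow> 'v \<Rightarrow> 'v \<Rightarrow> 'v" where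
  "ult_class N U f = mostowski (ult_carrier N U) (ult_mem U) (ult_eq N U `` {f})"

definition ult_emb :: "'v::zfc set \<Rightarrow> 'v \<Rightarrow> 'v \<Rightarrow> 'v" where
  "ult_emb N U x = ult_class N U (vlam (base U) (\<lambda>_. x))"

definition ult_id :: "'v::zfc set \<Rightarrow> 'v \<Rightarrow> 'v" where
  "ult_id N U = ult_class N U (vlam (base U) (\<lambda>x. x))"

definition uniform_on :: "'v::zfc \<Rightarrow> 'v \<Rightarrow> nat \<Rightarrow> bool" where
  "uniform_on U \<kappa> n \<longleftrightarrow>
     Ord \<kappa> \<and> cc_ultrafilter_on UNIV U (nsubsets \<kappa> n) \<and>
     (\<forall>\<alpha>\<in>elts \<kappa>. nsubsets \<alpha> n \<notin> elts U)"

definition uniform_ultrafilter :: "'v::zfc \<Rightarrow> bool" where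
  "uniform_ultrafilter U \<longleftrightarrow> (\<exists>\<kappa> n. uniform_on U \<kappa> n)"

definition sp :: "'v::zfc \<Rightarrow> 'v" where
  "sp U = (THE \<kappa>. \<exists>n. uniform_on U \<kappa> n)"

text \<open>The order on finite sets of ordinals.\<close>

definition fs_less :: "'v::zfc \<Rightarrow> 'v \<Rightarrow> bool" where
  "fs_less a b \<longleftrightarrow>
     (let D = (elts a - elts b) \<union> (elts b - elts a)
      in \<exists>m\<in>D. (\<forall>x\<in>D. x = m \<or> x \<in> elts m) \<and> m \<in> elts b)"

definition comparison :: "'v::zfc \<Rightarrow> 'v \<Rightarrow> 'v \<Rightarrow> 'v \<Rightarrow> bool" where
  "comparison U0 U1 W0 W1 \<longleftrightarrow>
     cc_ultrafilter (Ult UNIV U0) W0 \<and> cc_ultrafilter (Ult UNIV U1) W1 \<and>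
     Ult (Ult UNIV U0) W0 = Ult (Ult UNIV U1) W1 \<and>
     ult_emb (Ult UNIV U0) W0 \<circ> ult_emb UNIV U0 = ult_emb (Ult UNIV U1) W1 \<circ> ult_emb UNIV U1"

definition Ultrapower_Axiom :: "'v::zfc itself \<Rightarrow> bool" where
  "Ultrapower_Axiom _ \<longleftrightarrow>
     (\<forall>U0 U1 :: 'v. cc_ultrafilter UNIV U0 \<and> cc_ultrafilter UNIV U1
        \<longrightarrow> (\<exists>W0 W1. comparison U0 U1 W0 W1))"

definition seed_less :: "'v::zfc \<Rightarrow> 'v \<Rightarrow> bool"  (infix \<open><\<^sub>S\<close> 50) where
  "U0 <\<^sub>S U1 \<longleftrightarrow>
     (\<exists>W0 W1. comparison U0 U1 W0 W1 \<and>
        fs_less (ult_emb (Ult UNIV U0) W0 (ult_id UNIV U0))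
                (ult_emb (Ult UNIV U1) W1 (ult_id UNIV U1)))"

end

theory Submission
  imports Defs
begin

text \<open>
  Compare \<open>U\<^sub>0\<close> and \<open>U\<^sub>1\<close> by \<open>W\<^sub>0\<close> and \<open>W\<^sub>1\<close>, and suppose that the
  images \<open>a\<^sub>0\<close>, \<open>a\<^sub>1\<close> of the seeds do not satisfy \<open>a\<^sub>0 < a\<^sub>1\<close>.  The ultrafilter \<open>W\<^sub>0\<close> is
  represented by a family of ultrafilters \<open>w x\<close> in \<open>V\<close>, and \<open>Ult(Ult(V,U\<^sub>0),W\<^sub>0)\<close> by the family
  of the ultrapowers \<open>Ult(V,w x)\<close>; so \<open>a\<^sub>1\<close> is given by elements \<open>c x\<close> of \<open>Ult(V,w x)\<close>,
  and \<open>A \<in> U\<^sub>1\<close> holds iff \<open>c x\<close> lies in the image of \<open>A\<close> for \<open>U\<^sub>0\<close>-almost all \<open>x\<close>.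
  Since \<open>a\<^sub>1\<close> is at most \<open>a\<^sub>0\<close>, only the set of those \<open>b \<in> A\<close> that are at most \<open>x\<close> matters here, and
  such sets are subsets of \<open>P(\<alpha>)\<close> for some \<open>\<alpha> < sp U\<^sub>0\<close>.  This exhibits \<open>U\<^sub>1\<close> as a
  \<open>U\<^sub>0\<close>-limit of a family that is coded by a subset of \<open>2\<close> to the power \<open>< sp U\<^sub>0\<close>.  By hypothesis
  \<open>Ult(V,U\<^sub>1)\<close> contains the code and \<open>U\<^sub>0\<close>, hence it contains \<open>U\<^sub>1\<close>.

  But a nonprincipal \<open>U\<close> is never an element of \<open>M = Ult(V,U)\<close>.  Otherwise \<open>M\<close> computes
  \<open>j\<^sub>U\<close> correctly on the set underlying \<open>U\<close>, hence is closed under sequences indexed by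
  that set, hence computes \<open>j\<^sub>U\<close> correctly everywhere, and so \<open>M = V\<close>.  Then
  \<open>U\<close> and an element \<open>\<kappa>\<close> of \<open>j\<^sub>U(\<kappa>)\<close> are represented by families of pairs with the same
  property, contradicting the minimal choice of \<open>\<kappa>\<close>.
\<close>

section \<open>Sets and functions\<close>

text \<open>\<open>vset A\<close> has the intended elements only when the class \<open>A\<close> is
  a set, so every computation with \<open>elts (vset A)\<close> goes through this predicate.\<close>

definition small :: "'v::zfc set \<Rightarrow> bool" where
  "small A \<longleftrightarrow> (\<exists>x. elts x = A)"

lemma small_elts [simp, intro]: "small (elts x)"
  by (auto simp: small_def)

lemma elts_inject: "elts x = elts y \<longleftrightarrow> x = y"
  using extensionality by blast

lemma elts_vset [simp]: "small A \<Longrightarrow> elts (vset A) = A"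
  unfolding small_def vset_def using extensionality by (metis (mono_tags, lifting) the_equality)

lemma vset_elts [simp]: "vset (elts x) = x"
  by (rule extensionality) simp

lemma small_subset: "small B \<Longrightarrow> A \<subseteq> B \<Longrightarrow> small A"
proof -
  assume B: "small B" and AB: "A \<subseteq> B"
  obtain x where x: "elts x = B" using B by (auto simp: small_def)
  obtain z where "elts z = {y \<in> elts x. y \<in> A}" using separation [of x "\<lambda>y. y \<in> A"] by auto
  then have "elts z = A" using AB x by auto
  then show ?thesis unfolding small_def by auto
qed

lemma small_Collect [simp, intro]: "small {y \<in> elts x. P y}"
  by (rule small_subset [of "elts x"]) auto

lemma small_Int [simp, intro]: "small A \<Longrightarrow> small (A \<inter> B)"
  by (rule small_subset [of A]) auto

lemma small_Diff [simp, intro]: "small A \<Longrightarrow> small (A - B)"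
  by (rule small_subset [of A]) auto

lemma small_image [simp, intro]: "small (A :: 'v::zfc set) \<Longrightarrow> small ((F :: 'v \<Rightarrow> 'v) ` A)"
proof -
  assume "small A"
  then obtain x where x: "elts x = A" by (auto simp: small_def)
  show ?thesis using replacement [of F x] unfolding x small_def .
qed

lemma small_doubleton: "small {x, y}"
  unfolding small_def using pairing by blast

lemma small_UN [simp, intro]: "small (A :: 'v::zfc set) \<Longrightarrow> (\<And>x. x \<in> A \<Longrightarrow> small (B x :: 'v set)) \<Longrightarrow> small (\<Union>x\<in>A. B x)"
proof -
  assume A: "small A" and B: "\<And>x. x \<in> A \<Longrightarrow> small (B x)"
  obtain z where z: "elts z = (\<lambda>x. vset (B x)) ` A" using small_image [OF A, of "\<lambda>x. vset (B x)"] unfolding small_def by blast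
  obtain w where "elts w = (\<Union>y\<in>elts z. elts y)" using union by blast
  also have "\<dots> = (\<Union>x\<in>A. B x)" using z B by simp
  finally show ?thesis by (auto simp: small_def)
qed

lemma small_Un [simp, intro]: "small A \<Longrightarrow> small B \<Longrightarrow> small (A \<union> B)"
proof -
  assume A: "small A" and B: "small B"
  have "small (\<Union>y\<in>{vset A, vset B}. elts y)" by (intro small_UN small_doubleton) auto
  then show ?thesis using A B by simp
qed

lemma small_singleton [simp, intro]: "small {x}"
  using small_doubleton [of x x] by simp

lemma small_insert [simp, intro]: "small A \<Longrightarrow> small (insert x A)"
  using small_Un [OF small_singleton] by (metis insert_is_Un)

lemma small_empty [simp, intro]: "small {}"
  by (rule small_subset [OF small_singleton]) auto

lemma small_Pow: "small {y. elts y \<subseteq> elts x}"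
  unfolding small_def using powerset by blast

lemma elts_vpow [simp]: "elts (vpow x) = {y. elts y \<subseteq> elts x}"
  unfolding vpow_def by (rule elts_vset [OF small_Pow])

lemma small_subsets: "small A \<Longrightarrow> small {y. elts y \<subseteq> A}"
  by (metis elts_vset small_Pow)

lemma vset_inject: "small A \<Longrightarrow> small B \<Longrightarrow> vset A = vset B \<longleftrightarrow> A = B"
  by (metis elts_vset)

lemma mem_irrefl [simp]: "(x::'v::zfc) \<notin> elts x"
  using foundation [of "vset {x}"] by auto

section \<open>Numerals and countable classes\<close>

lemma vnat_less: "m < n \<Longrightarrow> (vnat m :: 'v::zfc) \<in> elts (vnat n)"
proof (induction n)
  case (Suc n) then show ?case by (auto simp: less_Suc_eq)
qed simp

lemma inj_vnat: "inj (vnat :: nat \<Rightarrow> 'v::zfc)"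
  by (rule linorder_injI) (metis mem_irrefl vnat_less)

lemma inv_vnat [simp]: "inv vnat (vnat n :: 'v::zfc) = n"
  by (rule inv_f_f [OF inj_vnat])

text \<open>Infinity supplies a set containing every numeral, so the numerals form a set;
  Replacement along \<open>F \<circ> inv vnat\<close> carries it to the range of any
  sequence.\<close>

lemma small_range_nat [simp, intro]: "small (range (F :: nat \<Rightarrow> 'v::zfc))"
proof -
  obtain w :: 'v where w: "\<exists>e\<in>elts w. elts e = {}"
      "\<forall>x\<in>elts w. \<exists>y\<in>elts w. elts y = insert x (elts x)" using infinity by blast
  have "vnat n \<in> elts w" for n
  proof (induction n)
    case 0 then show ?case using w(1) by (metis vnat.simps(1) vset_elts)
  next
    case (Suc n) then show ?case using w(2) by (metis vnat.simps(2) vset_elts)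
  qed
  then have "range (vnat :: nat \<Rightarrow> 'v) \<subseteq> elts w" by auto
  then have "small (range (vnat :: nat \<Rightarrow> 'v))" by (rule small_subset [OF small_elts])
  then have "small ((F \<circ> inv vnat) ` range (vnat :: nat \<Rightarrow> 'v))" by (rule small_image)
  then show ?thesis by (simp add: image_comp comp_def)
qed

lemma wf_mem: "wf {(y, x). y \<in> elts (x::'v::zfc)}"
proof (rule wfI_min)
  fix x :: 'v and Q assume "x \<in> Q"
  text \<open>Foundation is stated for sets, so it is applied to the members of the class \<open>Q\<close> in the
    transitive closure of \<open>x\<close>, built by iterating \<open>\<Union>\<close>.\<close>
  define step where "step = (\<lambda>A :: 'v set. \<Union>y\<in>A. elts y)"
  define cl where "cl = (\<lambda>n. (step ^^ n) {x})"
  have cl: "small (cl n)" for n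
    by (induction n) (auto simp: cl_def step_def)
  have "small (\<Union>y\<in>range (\<lambda>n. vset (cl n)). elts y)" by blast
  then have T: "small (\<Union>n. cl n)" using cl by simp
  define q where "q = vset ((\<Union>n. cl n) \<inter> Q)"
  have q: "elts q = (\<Union>n. cl n) \<inter> Q" unfolding q_def using T by simp
  have "x \<in> cl 0" by (simp add: cl_def)
  then have "elts q \<noteq> {}" using q \<open>x \<in> Q\<close> by auto
  then obtain y where y: "y \<in> elts q" "elts y \<inter> elts q = {}" using foundation by blast
  then obtain n where n: "y \<in> cl n" using q by auto
  have "z \<notin> Q" if "z \<in> elts y" for z
  proof
    assume "z \<in> Q"
    have "z \<in> cl (Suc n)" using n that by (auto simp: cl_def step_def)
    then have "z \<in> elts q" using q \<open>z \<in> Q\<close> by blast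
    then show False using y(2) that by blast
  qed
  then show "\<exists>z\<in>Q. \<forall>y. (y, z) \<in> {(y, x). y \<in> elts x} \<longrightarrow> y \<notin> Q"
    using y(1) q by auto
qed

lemma mem_induct [case_names mem]: "(\<And>x. (\<And>y. y \<in> elts x \<Longrightarrow> P y) \<Longrightarrow> P x) \<Longrightarrow> P (x::'v::zfc)"
  by (rule wf_induct [OF wf_mem]) auto

lemma mem_minimal:
  assumes "Q (x::'v::zfc)"
  obtains m where "Q m" "\<And>y. y \<in> elts m \<Longrightarrow> \<not> Q y"
proof (rule wfE_min [OF wf_mem, of x "Collect Q"])
  show "x \<in> Collect Q" using assms by simp
qed (use that in auto)

section \<open>Ordered pairs and functions as sets\<close>

lemma vpair_inject [simp]: "vpair a b = vpair c d \<longleftrightarrow> a = c \<and> b = d"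
  unfolding vpair_def by (auto simp: vset_inject small_doubleton doubleton_eq_iff)

lemma small_Times: "small A \<Longrightarrow> small B \<Longrightarrow> small {vpair x y |x y. x \<in> A \<and> y \<in> B}"
proof -
  assume "small A" "small B"
  then have "small (\<Union>x\<in>A. (\<lambda>y. vpair x y) ` B)" by auto
  also have "(\<Union>x\<in>A. (\<lambda>y. vpair x y) ` B) = {vpair x y |x y. x \<in> A \<and> y \<in> B}" by auto
  finally show ?thesis .
qed

lemma elts_vlam [simp]: "elts (vlam X F) = (\<lambda>x. vpair x (F x)) ` elts X"
  unfolding vlam_def by simp

lemma is_fun_vlam [simp, intro]: "is_fun (vlam X F) X"
  by (auto simp: is_fun_def)

lemma app_vlam [simp]: "x \<in> elts X \<Longrightarrow> app (vlam X F) x = F x"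
  unfolding app_def by (auto intro!: the_equality)

lemma vpair_app: "is_fun f X \<Longrightarrow> x \<in> elts X \<Longrightarrow> vpair x (app f x) \<in> elts f"
  unfolding app_def is_fun_def by (metis (mono_tags, lifting) theI')

lemma app_eq: "is_fun f X \<Longrightarrow> vpair x y \<in> elts f \<Longrightarrow> app f x = y"
  using vpair_app by (metis is_fun_def vpair_inject)

lemma is_fun_elts: "is_fun f X \<Longrightarrow> elts f = (\<lambda>x. vpair x (app f x)) ` elts X"
proof (intro set_eqI iffI)
  fix p assume f: "is_fun f X" and p: "p \<in> elts f"
  then obtain x y where x: "x \<in> elts X" and y: "p = vpair x y" unfolding is_fun_def by blast
  then have "app f x = y" using app_eq [OF f] p by simp
  then show "p \<in> (\<lambda>x. vpair x (app f x)) ` elts X" using x y by auto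
qed (auto intro: vpair_app)

lemma vlam_app: "is_fun f X \<Longrightarrow> vlam X (app f) = f"
  by (rule extensionality) (simp add: is_fun_elts)

lemma vlam_cong: "(\<And>x. x \<in> elts X \<Longrightarrow> F x = G x) \<Longrightarrow> vlam X F = vlam X G"
  unfolding vlam_def by (metis (no_types, lifting) image_cong)

lemma small_funs: "small Y \<Longrightarrow> small {f. is_fun f X \<and> (\<forall>x\<in>elts X. app f x \<in> Y)}"
proof (rule small_subset)
  assume Y: "small Y"
  show "small {f. elts f \<subseteq> {vpair x y |x y. x \<in> elts X \<and> y \<in> Y}}"
    by (intro small_subsets small_Times Y) simp
  show "{f. is_fun f X \<and> (\<forall>x\<in>elts X. app f x \<in> Y)} \<subseteq> {f. elts f \<subseteq> {vpair x y |x y. x \<in> elts X \<and> y \<in> Y}}"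
    by (auto simp: is_fun_elts)
qed

lemma elts_omega [simp]: "elts omega = range vnat"
  by (simp add: omega_def)

section \<open>Ultrapowers of the universe\<close>

text \<open>A map \<open>K\<close> that identifies exactly the equivalent functions, turns
  ultrapower membership into true membership and has a transitive image must be the collapse;
  well-foundedness is inherited from the universe through \<open>K\<close>. The lemma serves both
  for ultrapowers of the universe and for ultrapowers taken inside them.\<close>

lemma ult_collapse:
  fixes K :: "'v::zfc \<Rightarrow> 'v"
  assumes eq: "\<And>f g. f \<in> ult_funs N U \<Longrightarrow> g \<in> ult_funs N U \<Longrightarrow>
      K f = K g \<longleftrightarrow> vset {x \<in> elts (base U). app f x = app g x} \<in> elts U"
    and mem: "\<And>f g. f \<in> ult_funs N U \<Longrightarrow> g \<in> ult_funs N U \<Longrightarrow>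
      K f \<in> elts (K g) \<longleftrightarrow> vset {x \<in> elts (base U). app f x \<in> elts (app g x)} \<in> elts U"
    and onto: "\<And>g z. g \<in> ult_funs N U \<Longrightarrow> z \<in> elts (K g) \<Longrightarrow> \<exists>f\<in>ult_funs N U. z = K f"
  shows ult_collapse_class: "f \<in> ult_funs N U \<Longrightarrow> ult_class N U f = K f"
    and ult_collapse_Ult: "Ult N U = K ` ult_funs N U"
proof -
  define A where "A = ult_carrier N U"
  define E where "E = ult_mem U"
  define C where "C = (\<lambda>f. {g \<in> ult_funs N U. K g = K f})"
  have eqv: "ult_eq N U = {(f, g). f \<in> ult_funs N U \<and> g \<in> ult_funs N U \<and> K f = K g}"
    unfolding ult_eq_def using eq by blast
  have im: "ult_eq N U `` {f} = C f" if "f \<in> ult_funs N U" for f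
    using that unfolding eqv C_def by auto
  have A: "A = C ` ult_funs N U"
    unfolding A_def ult_carrier_def quotient_def using im by auto
  have E: "E (C f) (C g) \<longleftrightarrow> K f \<in> elts (K g)" if "f \<in> ult_funs N U" "g \<in> ult_funs N U" for f g
  proof -
    have *: "vset {x \<in> elts (base U). app f' x \<in> elts (app g' x)} \<in> elts U \<longleftrightarrow> K f \<in> elts (K g)"
      if "f' \<in> C f" "g' \<in> C g" for f' g'
      using mem [of f' g'] that by (simp add: C_def)
    have "f \<in> C f" "g \<in> C g" using that by (auto simp: C_def)
    then show ?thesis unfolding E_def ult_mem_def using * by blast
  qed
  define \<pi> where "\<pi> = (\<lambda>a. if a \<in> A then K (SOME f. f \<in> a) else undefined)"
  have \<pi>: "\<pi> (C f) = K f" if "f \<in> ult_funs N U" for f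
  proof -
    have "f \<in> C f" using that by (simp add: C_def)
    then have "(SOME g. g \<in> C f) \<in> C f" by (rule someI)
    moreover have "C f \<in> A" unfolding A using that by (rule imageI)
    ultimately show ?thesis by (simp add: \<pi>_def C_def)
  qed
  have "elts (\<pi> a) = \<pi> ` {b \<in> A. E b a}" if "a \<in> A" for a
  proof -
    obtain g where g: "g \<in> ult_funs N U" "a = C g" using \<open>a \<in> A\<close> A by blast
    have "elts (K g) = K ` {f \<in> ult_funs N U. K f \<in> elts (K g)}" using onto [OF g(1)] by blast
    also have "\<dots> = \<pi> ` C ` {f \<in> ult_funs N U. K f \<in> elts (K g)}"
      using \<pi> by (simp add: image_image)
    also have "C ` {f \<in> ult_funs N U. K f \<in> elts (K g)} = {b \<in> A. E b a}"
      using E g A by auto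
    finally show ?thesis using g \<pi> by simp
  qed
  moreover have "\<pi> a = undefined" if "a \<notin> A" for a using that by (simp add: \<pi>_def)
  ultimately have sol: "(\<forall>a\<in>A. elts (\<pi> a) = \<pi> ` {b \<in> A. E b a}) \<and> (\<forall>a. a \<notin> A \<longrightarrow> \<pi> a = undefined)"
    by blast
  have uniq: "\<rho> = \<pi>" if \<rho>: "(\<forall>a\<in>A. elts (\<rho> a) = \<rho> ` {b \<in> A. E b a}) \<and> (\<forall>a. a \<notin> A \<longrightarrow> \<rho> a = undefined)" for \<rho>
  proof (rule ext)
    fix a
    \<comment> \<open>The induction runs over the value \<open>\<pi> a\<close>: the
      \<open>E\<close>-predecessors of \<open>a\<close> have values that are elements of it.\<close>
    have "\<rho> a = \<pi> a" if "a \<in> A" "\<pi> a = z" for z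
      using that
    proof (induction z arbitrary: a rule: mem_induct)
      case (mem z)
      have "\<rho> b = \<pi> b" if "b \<in> A" "E b a" for b
      proof -
        have "\<pi> b \<in> elts z" using sol mem.prems that by blast
        then show ?thesis using mem.IH that by blast
      qed
      then have "\<rho> ` {b \<in> A. E b a} = \<pi> ` {b \<in> A. E b a}" by auto
      then show ?case using \<rho> sol mem.prems by (metis elts_inject)
    qed
    then show "\<rho> a = \<pi> a" using \<rho> sol by (cases "a \<in> A") simp_all
  qed
  have most: "mostowski A E = \<pi>"
    unfolding mostowski_def using sol uniq by (rule the_equality)
  show "ult_class N U f = K f" if "f \<in> ult_funs N U" for f
    unfolding ult_class_def im [OF that] using most \<pi> [OF that] by (simp add: A_def E_def)
  show "Ult N U = K ` ult_funs N U"
    unfolding Ult_def using most \<pi> A by (simp add: A_def E_def image_image)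
qed

lemma base_eq:
  assumes "cc_ultrafilter_on N U X" shows "base U = X"
proof (rule extensionality)
  have X: "X \<in> elts U" and sub: "\<And>A. A \<in> elts U \<Longrightarrow> elts A \<subseteq> elts X"
    using assms unfolding cc_ultrafilter_on_def ultrafilter_on_def by auto
  have "small (\<Union>A\<in>elts U. elts A)" by auto
  then have "elts (base U) = (\<Union>A\<in>elts U. elts A)" unfolding base_def by simp
  then show "elts (base U) = elts X" using X sub by blast
qed

text \<open>As a filter of the logic, \<open>U\<close> turns \<open>eventually\<close> into the
  quantifier "for almost all \<open>x\<close>". The abstraction is meaningful once the predicate is
  shown to be a filter.\<close>

definition ult_filter :: "'v::zfc \<Rightarrow> 'v filter" where
  "ult_filter U = Abs_filter (\<lambda>P. vset {x \<in> elts (base U). P x} \<in> elts U)"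

text \<open>Every element of \<open>Ult(V,U)\<close> has the form \<open>ucl U f\<close> for a function \<open>f\<close> of the logic;
  only its restriction to the set underlying \<open>U\<close> matters.\<close>

definition ucl :: "'v::zfc \<Rightarrow> ('v \<Rightarrow> 'v) \<Rightarrow> 'v" where
  "ucl U f = ult_class UNIV U (vlam (base U) f)"

section \<open>A countably complete ultrafilter as a quantifier\<close>

locale cc_ultra =
  fixes U :: "'v::zfc"
  assumes cc: "cc_ultrafilter UNIV U"
begin

abbreviation X :: 'v where "X \<equiv> base U"
abbreviation F :: "'v filter" where "F \<equiv> ult_filter U"
abbreviation cls :: "('v \<Rightarrow> 'v) \<Rightarrow> 'v" where "cls \<equiv> ucl U"
abbreviation M :: "'v set" where "M \<equiv> Ult UNIV U"

lemma cc_on: "cc_ultrafilter_on UNIV U X"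
  using cc base_eq unfolding cc_ultrafilter_def by metis

lemma uf: "ultrafilter_on UNIV U X"
  using cc_on unfolding cc_ultrafilter_on_def by blast

lemma is_filter: "is_filter (\<lambda>P. vset {x \<in> elts X. P x} \<in> elts U)"
proof
  show "vset {x \<in> elts X. True} \<in> elts U"
    using uf unfolding ultrafilter_on_def by simp
next
  fix P Q assume "vset {x \<in> elts X. P x} \<in> elts U" "vset {x \<in> elts X. Q x} \<in> elts U"
  then have "vset (elts (vset {x \<in> elts X. P x}) \<inter> elts (vset {x \<in> elts X. Q x})) \<in> elts U"
    using uf unfolding ultrafilter_on_def by blast
  moreover have "{x \<in> elts X. P x} \<inter> {x \<in> elts X. Q x} = {x \<in> elts X. P x \<and> Q x}" by blast
  ultimately show "vset {x \<in> elts X. P x \<and> Q x} \<in> elts U" by simp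
next
  fix P Q assume PQ: "\<forall>x. P x \<longrightarrow> Q x" and P: "vset {x \<in> elts X. P x} \<in> elts U"
  have "elts (vset {x \<in> elts X. P x}) \<subseteq> elts (vset {x \<in> elts X. Q x})"
       "elts (vset {x \<in> elts X. Q x}) \<subseteq> elts X" using PQ by auto
  then show "vset {x \<in> elts X. Q x} \<in> elts U"
    using uf P unfolding ultrafilter_on_def by blast
qed

lemma eventually_F: "eventually P F \<longleftrightarrow> vset {x \<in> elts X. P x} \<in> elts U"
  unfolding ult_filter_def using eventually_Abs_filter [OF is_filter] .

lemma ev_base: "eventually (\<lambda>x. x \<in> elts X) F"
  using uf unfolding eventually_F ultrafilter_on_def by simp

lemma F_not_bot [simp]: "F \<noteq> bot"
  using uf unfolding trivial_limit_def eventually_F ultrafilter_on_def by simp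

lemma ev_not [simp]: "eventually (\<lambda>x. \<not> P x) F \<longleftrightarrow> \<not> eventually P F"
proof
  assume "eventually (\<lambda>x. \<not> P x) F"
  then show "\<not> eventually P F" using F_not_bot eventually_elim2 [of "\<lambda>x. \<not> P x" F P "\<lambda>_. False"]
    by (auto simp: trivial_limit_def)
next
  assume *: "\<not> eventually P F"
  have "elts (vset {x \<in> elts X. P x}) \<subseteq> elts X" by auto
  then have "vset (elts X - elts (vset {x \<in> elts X. P x})) \<in> elts U"
    using uf * unfolding eventually_F ultrafilter_on_def by blast
  moreover have "elts X - {x \<in> elts X. P x} = {x \<in> elts X. \<not> P x}" by blast
  ultimately show "eventually (\<lambda>x. \<not> P x) F" unfolding eventually_F by simp
qed

lemma ev_disj: "eventually (\<lambda>x. P x \<or> Q x) F \<longleftrightarrow> eventually P F \<or> eventually Q F"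
  using ev_not [of "\<lambda>x. \<not> P x \<and> \<not> Q x"] by (simp add: eventually_conj_iff)

lemma ev_imp: "eventually (\<lambda>x. P x \<longrightarrow> Q x) F \<longleftrightarrow> (eventually P F \<longrightarrow> eventually Q F)"
  using ev_disj [of "\<lambda>x. \<not> P x" Q] by simp

lemma ev_iff: "eventually (\<lambda>x. P x \<longleftrightarrow> Q x) F \<longleftrightarrow> (eventually P F \<longleftrightarrow> eventually Q F)"
  unfolding iff_conv_conj_imp by (simp add: eventually_conj_iff ev_imp)

lemma ev_witness: assumes "eventually P F" obtains x where "x \<in> elts X" "P x"
proof -
  have "eventually (\<lambda>x. x \<in> elts X \<and> P x) F" using assms ev_base by (simp add: eventually_conj_iff)
  then show ?thesis using that eventually_happens' [OF F_not_bot] by blast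
qed

lemma mem_U_iff: "A \<in> elts U \<longleftrightarrow> elts A \<subseteq> elts X \<and> eventually (\<lambda>x. x \<in> elts A) F"
proof -
  have "vset {x \<in> elts X. x \<in> elts A} = A" if "elts A \<subseteq> elts X"
  proof -
    have "{x \<in> elts X. x \<in> elts A} = elts A" using that by blast
    then show ?thesis by simp
  qed
  then show ?thesis using uf unfolding eventually_F ultrafilter_on_def by metis
qed

lemma ev_countable: 
  assumes "\<And>n::nat. eventually (P n) F" shows "eventually (\<lambda>x. \<forall>n. P n x) F"
proof -
  define s where "s = vlam omega (\<lambda>m. vset {x \<in> elts X. P (inv (vnat :: nat \<Rightarrow> 'v) m) x})"
  have s: "app s (vnat n) = vset {x \<in> elts X. P n x}" for n
    unfolding s_def by simp
  have "is_fun s omega" unfolding s_def by simp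
  moreover have "\<forall>m\<in>elts omega. app s m \<in> elts U" using assms s by (auto simp: eventually_F)
  ultimately have "vset (\<Inter>m\<in>elts omega. elts (app s m)) \<in> elts U"
    using cc_on unfolding cc_ultrafilter_on_def by blast
  moreover have "(\<Inter>m\<in>elts omega. elts (app s m)) = {x \<in> elts X. \<forall>n. P n x}"
    using s by auto
  ultimately show ?thesis unfolding eventually_F by simp
qed

section \<open>The collapse of the ultrapower of the universe\<close>

definition E :: "(('v \<Rightarrow> 'v) \<times> ('v \<Rightarrow> 'v)) set" where
  "E = {(f, g). eventually (\<lambda>x. f x \<in> elts (g x)) F}"

text \<open>By countable completeness, an infinite descent of functions would be an infinite descent
  of sets at almost every point.\<close>

lemma wf_E: "wf E"
proof (rule ccontr)
  assume "\<not> wf E"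
  then obtain f where "\<And>n. (f (Suc n), f n) \<in> E" using wf_iff_no_infinite_down_chain by blast
  then have "eventually (\<lambda>x. \<forall>n. f (Suc n) x \<in> elts (f n x)) F"
    by (intro ev_countable) (auto simp: E_def)
  then obtain x where "\<And>n. f (Suc n) x \<in> elts (f n x)" using ev_witness by blast
  then have "\<exists>h. \<forall>n. (h (Suc n), h n) \<in> {(y, x). y \<in> elts (x::'v)}"
    by (intro exI [of _ "\<lambda>n. f n x"]) auto
  then show False using wf_mem wf_iff_no_infinite_down_chain by blast
qed

text \<open>The Mostowski recursion is done on functions instead of equivalence classes. That
  functions equal almost everywhere are collapsed together, and no others, is proved
  afterwards.\<close>

definition K :: "('v \<Rightarrow> 'v) \<Rightarrow> 'v" where
  "K = wfrec E (\<lambda>c g. vset (c ` {f. (f, g) \<in> E}))"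

lemma K_unfold: "K g = vset (K ` {f. (f, g) \<in> E})"
proof -
  have "K g = vset (cut K E g ` {f. (f, g) \<in> E})"
    unfolding K_def by (subst wfrec [OF wf_E]) simp
  also have "cut K E g ` {f. (f, g) \<in> E} = K ` {f. (f, g) \<in> E}"
    by (auto simp: cut_apply intro!: image_cong)
  finally show ?thesis .
qed

lemma K_cong: "eventually (\<lambda>x. f x = g x) F \<Longrightarrow> K f = K g"
proof -
  assume "eventually (\<lambda>x. f x = g x) F"
  then have "(h, f) \<in> E \<longleftrightarrow> (h, g) \<in> E" for h
    unfolding E_def by (auto elim: eventually_elim2)
  then show ?thesis using K_unfold [of f] K_unfold [of g] by simp
qed

text \<open>The functions below \<open>g\<close> form a proper class, but each agrees almost
  everywhere with a set function from \<open>X\<close> into a fixed set \<open>Y\<close>.\<close>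

lemma K_small: "small (K ` {f. (f, g) \<in> E})"
proof -
  \<comment> \<open>The extra element \<open>vset {}\<close> is the default value at the points
    where \<open>f x\<close> is not an element of \<open>g x\<close>.\<close>
  define Y where "Y = (\<Union>x\<in>elts X. elts (g x)) \<union> {vset {}}"
  have "small Y" unfolding Y_def by auto
  then have "small {h. is_fun h X \<and> (\<forall>x\<in>elts X. app h x \<in> Y)}" by (rule small_funs)
  then have "small ((\<lambda>h. K (app h)) ` {h. is_fun h X \<and> (\<forall>x\<in>elts X. app h x \<in> Y)})"
    by (rule small_image)
  moreover have "K ` {f. (f, g) \<in> E} \<subseteq> (\<lambda>h. K (app h)) ` {h. is_fun h X \<and> (\<forall>x\<in>elts X. app h x \<in> Y)}"
  proof
    fix z assume "z \<in> K ` {f. (f, g) \<in> E}"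
    then obtain f where f: "eventually (\<lambda>x. f x \<in> elts (g x)) F" "z = K f" by (auto simp: E_def)
    define h where "h = vlam X (\<lambda>x. if f x \<in> elts (g x) then f x else vset {})"
    have "eventually (\<lambda>x. f x = app h x) F"
      using f(1) ev_base by eventually_elim (simp add: h_def)
    then have "z = K (app h)" using f(2) K_cong by blast
    moreover have "is_fun h X \<and> (\<forall>x\<in>elts X. app h x \<in> Y)" by (auto simp: h_def Y_def)
    ultimately show "z \<in> (\<lambda>h. K (app h)) ` {h. is_fun h X \<and> (\<forall>x\<in>elts X. app h x \<in> Y)}" by blast
  qed
  ultimately show ?thesis by (rule small_subset)
qed

lemma elts_K: "elts (K g) = K ` {f. (f, g) \<in> E}"
  by (subst K_unfold) (rule elts_vset [OF K_small])

text \<open>If \<open>f\<close> and \<open>g\<close> differ almost everywhere, choose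
  \<open>z x\<close> in the symmetric difference of \<open>f x\<close> and \<open>g x\<close>. The
  ultrafilter decides on which side \<open>z\<close> lies, and in both cases the induction
  hypothesis is applied to a function below \<open>f\<close>.\<close>

lemma K_inj: "K f = K g \<Longrightarrow> eventually (\<lambda>x. f x = g x) F"
proof (induction f arbitrary: g rule: wf_induct_rule [OF wf_E])
  case (1 f)
  show ?case
  proof (rule ccontr)
    assume "\<not> eventually (\<lambda>x. f x = g x) F"
    then have ne: "eventually (\<lambda>x. f x \<noteq> g x) F" by simp
    define z where "z = (\<lambda>x. SOME y. y \<in> elts (f x) - elts (g x) \<or> y \<in> elts (g x) - elts (f x))"
    have "eventually (\<lambda>x. z x \<in> elts (f x) - elts (g x) \<or> z x \<in> elts (g x) - elts (f x)) F"
      using ne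
    proof eventually_elim
      case (elim x)
      then have "elts (f x) \<noteq> elts (g x)" by (simp add: elts_inject)
      then have "\<exists>y. y \<in> elts (f x) - elts (g x) \<or> y \<in> elts (g x) - elts (f x)" by blast
      then show ?case unfolding z_def by (rule someI_ex)
    qed
    then consider "(z, f) \<in> E" "(z, g) \<notin> E" | "(z, g) \<in> E" "(z, f) \<notin> E"
      by (auto simp: ev_disj eventually_conj_iff E_def)
    then show False
    proof cases
      case 1
      then have "K z \<in> elts (K g)" using elts_K [of f] \<open>K f = K g\<close> by auto
      then obtain y where y: "(y, g) \<in> E" "K z = K y" using elts_K by blast
      have "eventually (\<lambda>x. z x = y x) F" using "1.IH" 1(1) y(2) by blast
      then have "(z, g) \<in> E" using y(1) unfolding E_def by (auto elim: eventually_elim2)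
      then show False using 1 by blast
    next
      case 2
      then have "K z \<in> elts (K f)" using elts_K [of g] \<open>K f = K g\<close> by auto
      then obtain y where y: "(y, f) \<in> E" "K y = K z" using elts_K by (metis (mono_tags, lifting) image_iff mem_Collect_eq)
      have "eventually (\<lambda>x. y x = z x) F" using "1.IH" y by blast
      then have "(z, f) \<in> E" using y(1) unfolding E_def by (auto elim: eventually_elim2)
      then show False using 2 by blast
    qed
  qed
qed

lemma K_eq_iff: "K f = K g \<longleftrightarrow> eventually (\<lambda>x. f x = g x) F"
  using K_inj K_cong by blast

lemma K_mem_iff: "K f \<in> elts (K g) \<longleftrightarrow> eventually (\<lambda>x. f x \<in> elts (g x)) F"
proof
  assume "K f \<in> elts (K g)"
  then obtain h where h: "(h, g) \<in> E" "K f = K h" using elts_K by blast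
  then have "eventually (\<lambda>x. f x = h x) F" by (simp add: K_eq_iff)
  then show "eventually (\<lambda>x. f x \<in> elts (g x)) F" using h(1) unfolding E_def by (auto elim: eventually_elim2)
qed (auto simp: elts_K E_def)

text \<open>Every function of the logic agrees almost everywhere with its restriction to
  \<open>X\<close>, which is a set. Hence \<open>K\<close> meets the requirements of
  \<open>ult_collapse\<close>.\<close>

lemma
  shows ult_class_K: "is_fun f X \<Longrightarrow> ult_class UNIV U f = K (app f)"
    and Ult_K: "M = range K"
proof -
  have fv: "\<exists>h\<in>ult_funs UNIV U. K f = K (app h)" for f
  proof
    show "vlam X f \<in> ult_funs UNIV U" by (simp add: ult_funs_def)
    have "eventually (\<lambda>x. f x = app (vlam X f) x) F" using ev_base by eventually_elim simp
    then show "K f = K (app (vlam X f))" by (rule K_cong)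
  qed
  have onto: "\<exists>f\<in>ult_funs UNIV U. z = K (app f)" if "z \<in> elts (K (app g))" for g z
    using that fv elts_K by fastforce
  show "ult_class UNIV U f = K (app f)" if "is_fun f X" for f
    by (rule ult_collapse_class [of UNIV U "\<lambda>f. K (app f)"])
       (use onto that in \<open>auto simp: K_eq_iff K_mem_iff eventually_F ult_funs_def\<close>)
  have "M = (\<lambda>f. K (app f)) ` ult_funs UNIV U"
    by (rule ult_collapse_Ult) (use onto in \<open>auto simp: K_eq_iff K_mem_iff eventually_F\<close>)
  then show "M = range K" using fv by blast
qed

lemma cls_eq_K: "cls = K"
proof
  fix f
  have "eventually (\<lambda>x. app (vlam X f) x = f x) F" using ev_base by eventually_elim simp
  then show "cls f = K f" unfolding ucl_def by (simp add: ult_class_K K_eq_iff)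
qed

lemma cls_eq_iff: "cls f = cls g \<longleftrightarrow> eventually (\<lambda>x. f x = g x) F"
  unfolding cls_eq_K by (rule K_eq_iff)

lemma cls_mem_iff: "cls f \<in> elts (cls g) \<longleftrightarrow> eventually (\<lambda>x. f x \<in> elts (g x)) F"
  unfolding cls_eq_K by (rule K_mem_iff)

lemma M_eq: "M = range cls"
  unfolding cls_eq_K by (rule Ult_K)

lemma cls_in_M [simp, intro]: "cls f \<in> M"
  by (simp add: M_eq)

lemma M_cases: assumes "y \<in> M" obtains f where "y = cls f"
  using assms M_eq by blast

lemma M_trans: "y \<in> M \<Longrightarrow> z \<in> elts y \<Longrightarrow> z \<in> M"
  using elts_K cls_eq_K M_eq by auto

lemma elts_cls_cases:
  assumes "z \<in> elts (cls g)" obtains f where "z = cls f" "eventually (\<lambda>x. f x \<in> elts (g x)) F"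
  using assms M_trans [OF cls_in_M] M_cases cls_mem_iff by metis

lemma emb_eq: "ult_emb UNIV U x = cls (\<lambda>_. x)"
  by (simp add: ult_emb_def ucl_def)

lemma id_eq: "ult_id UNIV U = cls (\<lambda>x. x)"
  by (simp add: ult_id_def ucl_def)

lemma cls_cong: "eventually (\<lambda>x. f x = g x) F \<Longrightarrow> cls f = cls g"
  by (simp add: cls_eq_iff)

lemma ev_choice:
  assumes "eventually (\<lambda>x. \<exists>y. P x y) F"
  obtains f where "eventually (\<lambda>x. P x (f x)) F"
proof -
  have "eventually (\<lambda>x. P x (SOME y. P x y)) F"
    using assms by eventually_elim (rule someI_ex)
  then show ?thesis by (rule that)
qed

text \<open>This is the quantifier step of the theorem of Los: counterexamples at almost all points
  are chosen as the values of a single function.\<close>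

lemma ev_all:
  assumes "\<And>f. eventually (\<lambda>x. P x (f x)) F" shows "eventually (\<lambda>x. \<forall>y. P x y) F"
proof (rule ccontr)
  assume "\<not> eventually (\<lambda>x. \<forall>y. P x y) F"
  then have "eventually (\<lambda>x. \<exists>y. \<not> P x y) F"
    using ev_not [of "\<lambda>x. \<forall>y. P x y"] by (simp del: ev_not)
  then obtain f where "eventually (\<lambda>x. \<not> P x (f x)) F" by (rule ev_choice)
  then show False using assms by simp
qed

lemma cls_subset_iff: "elts (cls f) \<subseteq> elts (cls g) \<longleftrightarrow> eventually (\<lambda>x. elts (f x) \<subseteq> elts (g x)) F"
proof
  assume *: "elts (cls f) \<subseteq> elts (cls g)"
  have "eventually (\<lambda>x. h x \<in> elts (f x) \<longrightarrow> h x \<in> elts (g x)) F" for h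
    using * cls_mem_iff by (auto simp: ev_imp)
  then have "eventually (\<lambda>x. \<forall>y. y \<in> elts (f x) \<longrightarrow> y \<in> elts (g x)) F" by (rule ev_all)
  then show "eventually (\<lambda>x. elts (f x) \<subseteq> elts (g x)) F" by eventually_elim blast
next
  assume *: "eventually (\<lambda>x. elts (f x) \<subseteq> elts (g x)) F"
  show "elts (cls f) \<subseteq> elts (cls g)"
  proof
    fix z assume "z \<in> elts (cls f)"
    then obtain h where h: "z = cls h" "eventually (\<lambda>x. h x \<in> elts (f x)) F" by (rule elts_cls_cases)
    then have "eventually (\<lambda>x. h x \<in> elts (g x)) F" using * by (auto elim: eventually_elim2)
    then show "z \<in> elts (cls g)" using h by (simp add: cls_mem_iff)
  qed
qed

end

section \<open>The theorem of Los\<close>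

lemma small_INT_omega: "small (\<Inter>n\<in>elts omega. elts (S n :: 'v::zfc))"
  by (rule small_subset [of "elts (S (vnat 0))"]) (auto simp del: vnat.simps)

context cc_ultra
begin

lemma ev_all2:
  assumes "\<And>f g. eventually (\<lambda>x. P x (f x) (g x)) F" shows "eventually (\<lambda>x. \<forall>y z. P x y z) F"
proof (rule ev_all)
  fix f show "eventually (\<lambda>x. \<forall>z. P x (f x) z) F" by (rule ev_all) (rule assms)
qed

lemma ev_imp_all:
  assumes "\<And>f. eventually (\<lambda>x. P x (f x)) F \<Longrightarrow> eventually (\<lambda>x. Q x (f x)) F"
  shows "eventually (\<lambda>x. \<forall>y. P x y \<longrightarrow> Q x y) F"
  by (rule ev_all) (use assms in \<open>simp add: ev_imp\<close>)

lemma elts_cls_eqI: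
  assumes "\<And>f. eventually (\<lambda>x. f x \<in> elts (g x)) F \<longleftrightarrow> cls f \<in> A" and "A \<subseteq> M"
  shows "elts (cls g) = A"
proof
  show "elts (cls g) \<subseteq> A"
  proof
    fix z assume "z \<in> elts (cls g)"
    then obtain f where "z = cls f" "eventually (\<lambda>x. f x \<in> elts (g x)) F" by (rule elts_cls_cases)
    then show "z \<in> A" using assms by blast
  qed
  show "A \<subseteq> elts (cls g)"
  proof
    fix z assume z: "z \<in> A"
    then obtain f where "z = cls f" using assms M_cases by blast
    then show "z \<in> elts (cls g)" using assms z by (simp add: cls_mem_iff)
  qed
qed

text \<open>Los for separation. The predicate \<open>Q\<close> on \<open>M\<close> may be defined
  externally, as long as the pointwise predicates \<open>P x\<close> represent it on
  \<open>cls h\<close>; this is how sets are shown to belong to \<open>M\<close>.\<close>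

lemma cls_Collect:
  assumes "\<And>f. cls f \<in> elts (cls h) \<Longrightarrow> eventually (\<lambda>x. P x (f x)) F \<longleftrightarrow> Q (cls f)"
  shows "elts (cls (\<lambda>x. vset {y \<in> elts (h x). P x y})) = {y \<in> elts (cls h). Q y}"
proof (rule elts_cls_eqI)
  fix f
  show "eventually (\<lambda>x. f x \<in> elts (vset {y \<in> elts (h x). P x y})) F \<longleftrightarrow> cls f \<in> {y \<in> elts (cls h). Q y}"
    using assms [of f] by (auto simp: eventually_conj_iff cls_mem_iff)
qed (use M_trans [OF cls_in_M] in blast)

lemma cls_insert: "cls (\<lambda>x. vset (insert (a x) (elts (b x)))) = vset (insert (cls a) (elts (cls b)))"
proof (rule extensionality)
  have "elts (cls (\<lambda>x. vset (insert (a x) (elts (b x))))) = insert (cls a) (elts (cls b))"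
    by (rule elts_cls_eqI) (use M_trans [OF cls_in_M] in \<open>auto simp: ev_disj cls_mem_iff cls_eq_iff\<close>)
  then show "elts (cls (\<lambda>x. vset (insert (a x) (elts (b x))))) = elts (vset (insert (cls a) (elts (cls b))))"
    by simp
qed

lemma cls_empty [simp]: "cls (\<lambda>_. vset {}) = vset {}"
proof (rule extensionality)
  have "elts (cls (\<lambda>_. vset {})) = {}" by (rule elts_cls_eqI) auto
  then show "elts (cls (\<lambda>_. vset {})) = elts (vset {})" by simp
qed

lemma cls_doubleton: "cls (\<lambda>x. vset {a x, b x}) = vset {cls a, cls b}"
  using cls_insert [of a "\<lambda>x. vset {b x}"] cls_insert [of b "\<lambda>x. vset {}"] by simp

lemma cls_vpair: "cls (\<lambda>x. vpair (a x) (b x)) = vpair (cls a) (cls b)"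
  unfolding vpair_def cls_doubleton using cls_doubleton [of a a] by simp

lemma vpair_M: assumes "vpair a b \<in> M" shows "a \<in> M" "b \<in> M"
proof -
  have "vset {a, b} \<in> elts (vpair a b)" unfolding vpair_def by (simp add: small_doubleton)
  then have "vset {a, b} \<in> M" using assms M_trans by blast
  then show "a \<in> M" "b \<in> M" using M_trans [of "vset {a, b}"] by (auto simp: small_doubleton)
qed

lemma cls_vnat [simp]: "cls (\<lambda>_. vnat n) = vnat n"
  by (induction n) (simp_all add: cls_insert)

text \<open>A function into \<open>omega\<close> that differs almost everywhere from each numeral
  would, by countable completeness, avoid all of them at once.\<close>

lemma cls_omega [simp]: "cls (\<lambda>_. omega) = omega"
proof (rule extensionality)
  have "elts (cls (\<lambda>_. omega)) = range vnat"
  proof (rule elts_cls_eqI)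
    fix f
    show "eventually (\<lambda>x. f x \<in> elts omega) F \<longleftrightarrow> cls f \<in> range vnat"
    proof
      assume *: "eventually (\<lambda>x. f x \<in> elts omega) F"
      show "cls f \<in> range vnat"
      proof (rule ccontr)
        assume "cls f \<notin> range vnat"
        then have "eventually (\<lambda>x. f x \<noteq> vnat n) F" for n
          using cls_eq_iff [of f "\<lambda>_. vnat n"] by auto
        then have "eventually (\<lambda>x. \<forall>n. f x \<noteq> vnat n) F" by (rule ev_countable)
        then have "eventually (\<lambda>x. f x \<in> elts omega \<and> (\<forall>n. f x \<noteq> vnat n)) F"
          using * by (rule eventually_conj [rotated])
        then show False by (rule ev_witness) auto
      qed
    next
      assume "cls f \<in> range vnat"
      then obtain n where "cls f = cls (\<lambda>_. vnat n)" by auto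
      then have "eventually (\<lambda>x. f x = vnat n) F" unfolding cls_eq_iff .
      then show "eventually (\<lambda>x. f x \<in> elts omega) F" by eventually_elim auto
    qed
  next
    show "range vnat \<subseteq> M" using cls_vnat cls_in_M by (metis image_subsetI)
  qed
  then show "elts (cls (\<lambda>_. omega)) = elts omega" by simp
qed

lemma elts_cls_vlam:
  "elts (cls (\<lambda>x. vlam (h x) (G x))) = {vpair (cls a) (cls (\<lambda>x. G x (a x))) |a. cls a \<in> elts (cls h)}"
    (is "_ = ?A")
proof (rule elts_cls_eqI)
  show "?A \<subseteq> M" using cls_vpair cls_in_M by (auto simp del: cls_in_M) (metis cls_in_M)
  fix f
  show "eventually (\<lambda>x. f x \<in> elts (vlam (h x) (G x))) F \<longleftrightarrow> cls f \<in> ?A"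
  proof
    assume "eventually (\<lambda>x. f x \<in> elts (vlam (h x) (G x))) F"
    then have "eventually (\<lambda>x. \<exists>y. y \<in> elts (h x) \<and> f x = vpair y (G x y)) F"
      by eventually_elim auto
    then obtain a where "eventually (\<lambda>x. a x \<in> elts (h x) \<and> f x = vpair (a x) (G x (a x))) F"
      by (rule ev_choice)
    then have "cls a \<in> elts (cls h)" "cls f = cls (\<lambda>x. vpair (a x) (G x (a x)))"
      by (auto simp: cls_mem_iff cls_eq_iff eventually_conj_iff)
    then show "cls f \<in> ?A" by (auto simp: cls_vpair)
  next
    assume "cls f \<in> ?A"
    then obtain a where "cls a \<in> elts (cls h)" "cls f = cls (\<lambda>x. vpair (a x) (G x (a x)))"
      by (auto simp: cls_vpair)
    then have "eventually (\<lambda>x. a x \<in> elts (h x) \<and> f x = vpair (a x) (G x (a x))) F"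
      by (simp add: cls_mem_iff cls_eq_iff eventually_conj_iff)
    then show "eventually (\<lambda>x. f x \<in> elts (vlam (h x) (G x))) F" by eventually_elim auto
  qed
qed

lemma cls_vlam:
  assumes "\<And>a. cls a \<in> elts (cls h) \<Longrightarrow> cls (\<lambda>x. G x (a x)) = H (cls a)"
  shows "cls (\<lambda>x. vlam (h x) (G x)) = vlam (cls h) H"
proof (rule extensionality)
  have "elts (cls h) = cls ` {a. cls a \<in> elts (cls h)}"
    by (auto elim: elts_cls_cases)
  then have "elts (vlam (cls h) H) = (\<lambda>a. vpair (cls a) (H (cls a))) ` {a. cls a \<in> elts (cls h)}"
    unfolding elts_vlam by (metis (no_types, lifting) image_cong image_image)
  also have "\<dots> = (\<lambda>a. vpair (cls a) (cls (\<lambda>x. G x (a x)))) ` {a. cls a \<in> elts (cls h)}"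
    by (rule image_cong) (simp_all add: assms)
  finally show "elts (cls (\<lambda>x. vlam (h x) (G x))) = elts (vlam (cls h) H)"
    unfolding elts_cls_vlam by (simp add: setcompr_eq_image)
qed

lemma is_fun_cls_vlam: "is_fun (cls (\<lambda>x. vlam (h x) (G x))) (cls h)"
proof -
  \<comment> \<open>A representing function is chosen for each argument; the value does not depend
    on the choice, which is what \<open>cls_vlam\<close> asks for.\<close>
  define H where "H = (\<lambda>y. cls (\<lambda>x. G x ((SOME a. cls a = y) x)))"
  have "cls (\<lambda>x. G x (a x)) = H (cls a)" for a
  proof -
    have "cls (SOME b. cls b = cls a) = cls a" by (rule someI [of _ a]) (rule refl)
    then have "eventually (\<lambda>x. (SOME b. cls b = cls a) x = a x) F" unfolding cls_eq_iff .
    then show ?thesis unfolding H_def cls_eq_iff by eventually_elim simp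
  qed
  then have "cls (\<lambda>x. vlam (h x) (G x)) = vlam (cls h) H" by (rule cls_vlam)
  then show ?thesis by simp
qed

text \<open>From right to left, almost every \<open>f x\<close> is the \<open>vlam\<close> of its
  own values. From left to right, each clause of \<open>is_fun\<close> is transferred to almost all
  points by testing it on arbitrary representing functions.\<close>

lemma is_fun_cls_iff: "is_fun (cls f) (cls h) \<longleftrightarrow> eventually (\<lambda>x. is_fun (f x) (h x)) F"
proof
  assume "eventually (\<lambda>x. is_fun (f x) (h x)) F"
  then have "eventually (\<lambda>x. f x = vlam (h x) (app (f x))) F" by eventually_elim (simp add: vlam_app)
  then have "cls f = cls (\<lambda>x. vlam (h x) (app (f x)))" by (rule cls_cong)
  then show "is_fun (cls f) (cls h)" by (simp add: is_fun_cls_vlam)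
next
  assume f: "is_fun (cls f) (cls h)"
  have 1: "eventually (\<lambda>x. \<forall>p. p \<in> elts (f x) \<longrightarrow> (\<exists>y\<in>elts (h x). \<exists>z. p = vpair y z)) F"
  proof (rule ev_imp_all)
    fix p assume "eventually (\<lambda>x. p x \<in> elts (f x)) F"
    then have p: "cls p \<in> elts (cls f)" by (simp add: cls_mem_iff)
    then obtain y z where yz: "y \<in> elts (cls h)" "cls p = vpair y z" using f unfolding is_fun_def by blast
    then have "vpair y z \<in> M" using cls_in_M by metis
    then obtain a b where "y = cls a" "z = cls b" using M_cases vpair_M by metis
    then have "eventually (\<lambda>x. a x \<in> elts (h x)) F" "eventually (\<lambda>x. p x = vpair (a x) (b x)) F"
      using yz by (simp_all flip: cls_mem_iff cls_eq_iff cls_vpair)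
    then show "eventually (\<lambda>x. \<exists>y\<in>elts (h x). \<exists>z. p x = vpair y z) F" by eventually_elim auto
  qed
  have 2: "eventually (\<lambda>x. \<forall>y. y \<in> elts (h x) \<longrightarrow> (\<exists>z. vpair y z \<in> elts (f x))) F"
  proof (rule ev_imp_all)
    fix a assume "eventually (\<lambda>x. a x \<in> elts (h x)) F"
    then have a: "cls a \<in> elts (cls h)" by (simp add: cls_mem_iff)
    then have *: "vpair (cls a) (app (cls f) (cls a)) \<in> elts (cls f)" using f vpair_app by blast
    then have "vpair (cls a) (app (cls f) (cls a)) \<in> M" using M_trans cls_in_M by blast
    then obtain b where "app (cls f) (cls a) = cls b" using vpair_M M_cases by metis
    then have "eventually (\<lambda>x. vpair (a x) (b x) \<in> elts (f x)) F"
      using * by (simp flip: cls_mem_iff cls_vpair)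
    then show "eventually (\<lambda>x. \<exists>z. vpair (a x) z \<in> elts (f x)) F" by eventually_elim auto
  qed
  have 3: "eventually (\<lambda>x. \<forall>y z z'. vpair y z \<in> elts (f x) \<and> vpair y z' \<in> elts (f x) \<longrightarrow> z = z') F"
  proof (rule ev_all, rule ev_all2)
    fix a b c
    have "cls b = cls c" if "vpair (cls a) (cls b) \<in> elts (cls f)" "vpair (cls a) (cls c) \<in> elts (cls f)"
      using app_eq [OF f that(1)] app_eq [OF f that(2)] by simp
    then show "eventually (\<lambda>x. vpair (a x) (b x) \<in> elts (f x) \<and> vpair (a x) (c x) \<in> elts (f x) \<longrightarrow> b x = c x) F"
      by (simp add: ev_imp eventually_conj_iff flip: cls_mem_iff cls_vpair cls_eq_iff)
  qed
  show "eventually (\<lambda>x. is_fun (f x) (h x)) F"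
    using 1 2 3
  proof eventually_elim
    case (elim x)
    then show ?case unfolding is_fun_def by blast
  qed
qed

lemma cls_app:
  assumes f: "is_fun (cls f) (cls h)" and a: "cls a \<in> elts (cls h)"
  shows "cls (\<lambda>x. app (f x) (a x)) = app (cls f) (cls a)"
proof -
  have "eventually (\<lambda>x. is_fun (f x) (h x)) F" "eventually (\<lambda>x. a x \<in> elts (h x)) F"
    using f a by (simp_all add: is_fun_cls_iff cls_mem_iff)
  then have "eventually (\<lambda>x. vpair (a x) (app (f x) (a x)) \<in> elts (f x)) F"
    by eventually_elim (rule vpair_app)
  then have "vpair (cls a) (cls (\<lambda>x. app (f x) (a x))) \<in> elts (cls f)"
    by (simp flip: cls_vpair add: cls_mem_iff)
  then show ?thesis using app_eq [OF f] by simp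
qed

lemma cls_Int: "cls (\<lambda>x. vset (elts (a x) \<inter> elts (b x))) = vset (elts (cls a) \<inter> elts (cls b))"
proof (rule extensionality)
  have "elts (cls (\<lambda>x. vset {y \<in> elts (a x). y \<in> elts (b x)})) = {y \<in> elts (cls a). y \<in> elts (cls b)}"
    by (rule cls_Collect) (simp add: cls_mem_iff)
  then show "elts (cls (\<lambda>x. vset (elts (a x) \<inter> elts (b x)))) = elts (vset (elts (cls a) \<inter> elts (cls b)))"
    by (simp add: Int_def)
qed

lemma cls_Diff: "cls (\<lambda>x. vset (elts (a x) - elts (b x))) = vset (elts (cls a) - elts (cls b))"
proof (rule extensionality)
  have "elts (cls (\<lambda>x. vset {y \<in> elts (a x). y \<notin> elts (b x)})) = {y \<in> elts (cls a). y \<notin> elts (cls b)}"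
    by (rule cls_Collect) (simp add: cls_mem_iff)
  then show "elts (cls (\<lambda>x. vset (elts (a x) - elts (b x)))) = elts (vset (elts (cls a) - elts (cls b)))"
    by (simp add: set_diff_eq)
qed

text \<open>Here \<open>omega\<close> is fixed by the embedding, and countable completeness
  exchanges the quantifier over its elements with \<open>eventually\<close>.\<close>

lemma cls_INT:
  assumes "is_fun (cls s) omega"
  shows "cls (\<lambda>x. vset (\<Inter>n\<in>elts omega. elts (app (s x) n))) = vset (\<Inter>n\<in>elts omega. elts (app (cls s) n))"
proof (rule extensionality)
  have app: "cls (\<lambda>x. app (s x) (vnat n)) = app (cls s) (vnat n)" for n
    using cls_app [of s "\<lambda>_. omega" "\<lambda>_. vnat n"] assms by simp
  have "elts (cls (\<lambda>x. vset (\<Inter>n\<in>elts omega. elts (app (s x) n)))) = (\<Inter>n\<in>elts omega. elts (app (cls s) n))"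
  proof (rule elts_cls_eqI)
    fix f
    have "eventually (\<lambda>x. f x \<in> elts (vset (\<Inter>n\<in>elts omega. elts (app (s x) n)))) F
        \<longleftrightarrow> eventually (\<lambda>x. \<forall>n. f x \<in> elts (app (s x) (vnat n))) F"
      by (simp add: small_INT_omega del: elts_omega) simp
    also have "\<dots> \<longleftrightarrow> (\<forall>n. eventually (\<lambda>x. f x \<in> elts (app (s x) (vnat n))) F)"
      by (auto intro: ev_countable elim: eventually_mono)
    also have "\<dots> \<longleftrightarrow> cls f \<in> (\<Inter>n\<in>elts omega. elts (app (cls s) n))"
      by (simp flip: app cls_mem_iff)
    finally show "eventually (\<lambda>x. f x \<in> elts (vset (\<Inter>n\<in>elts omega. elts (app (s x) n)))) F
        \<longleftrightarrow> cls f \<in> (\<Inter>n\<in>elts omega. elts (app (cls s) n))" .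
  next
    have "app (cls s) (vnat 0) \<in> M" unfolding app [symmetric] by (rule cls_in_M)
    then have "elts (app (cls s) (vnat 0)) \<subseteq> M" using M_trans by blast
    then show "(\<Inter>n\<in>elts omega. elts (app (cls s) n)) \<subseteq> M" by (auto simp del: vnat.simps)
  qed
  then show "elts (cls (\<lambda>x. vset (\<Inter>n\<in>elts omega. elts (app (s x) n))))
      = elts (vset (\<Inter>n\<in>elts omega. elts (app (cls s) n)))"
    by (simp add: small_INT_omega del: elts_omega)
qed

text \<open>The quantifiers relativized to \<open>M\<close> range over the classes
  \<open>cls a\<close> of all functions \<open>a\<close>, so \<open>ev_all\<close> moves each clause
  of the definition to almost all fibres, where the quantifiers range over the whole
  universe.\<close>

lemma ultrafilter_cls:
  assumes "ultrafilter_on M (cls w) (cls h)"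
  shows "eventually (\<lambda>x. ultrafilter_on UNIV (w x) (h x)) F"
proof -
  note u = assms [unfolded ultrafilter_on_def]
  have 1: "eventually (\<lambda>x. \<forall>A. A \<in> elts (w x) \<longrightarrow> elts A \<subseteq> elts (h x)) F"
    by (rule ev_imp_all) (use u in \<open>simp flip: cls_mem_iff cls_subset_iff\<close>)
  have 2: "eventually (\<lambda>x. h x \<in> elts (w x)) F" using u by (simp flip: cls_mem_iff)
  have 3: "eventually (\<lambda>x. vset {} \<notin> elts (w x)) F"
  proof -
    have "cls (\<lambda>x. vset {}) \<notin> elts (cls w)" unfolding cls_empty using u by blast
    then show ?thesis unfolding cls_mem_iff by simp
  qed
  have 4: "eventually (\<lambda>x. \<forall>A B. A \<in> elts (w x) \<and> B \<in> elts (w x) \<longrightarrow> vset (elts A \<inter> elts B) \<in> elts (w x)) F"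
  proof (rule ev_all2)
    fix a b
    have "cls a \<in> elts (cls w) \<and> cls b \<in> elts (cls w) \<longrightarrow> cls (\<lambda>x. vset (elts (a x) \<inter> elts (b x))) \<in> elts (cls w)"
      unfolding cls_Int using u by blast
    then show "eventually (\<lambda>x. a x \<in> elts (w x) \<and> b x \<in> elts (w x) \<longrightarrow> vset (elts (a x) \<inter> elts (b x)) \<in> elts (w x)) F"
      by (simp add: ev_imp eventually_conj_iff cls_mem_iff)
  qed
  have 5: "eventually (\<lambda>x. \<forall>A B. A \<in> elts (w x) \<and> elts A \<subseteq> elts B \<and> elts B \<subseteq> elts (h x) \<longrightarrow> B \<in> elts (w x)) F"
  proof (rule ev_all2)
    fix a b
    have "cls a \<in> elts (cls w) \<and> elts (cls a) \<subseteq> elts (cls b) \<and> elts (cls b) \<subseteq> elts (cls h) \<longrightarrow> cls b \<in> elts (cls w)"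
      using u by blast
    then show "eventually (\<lambda>x. a x \<in> elts (w x) \<and> elts (a x) \<subseteq> elts (b x) \<and> elts (b x) \<subseteq> elts (h x) \<longrightarrow> b x \<in> elts (w x)) F"
      by (simp add: ev_imp eventually_conj_iff cls_mem_iff cls_subset_iff)
  qed
  have 6: "eventually (\<lambda>x. \<forall>A. elts A \<subseteq> elts (h x) \<longrightarrow> A \<in> elts (w x) \<or> vset (elts (h x) - elts A) \<in> elts (w x)) F"
  proof (rule ev_all)
    fix a
    have "elts (cls a) \<subseteq> elts (cls h) \<longrightarrow> cls a \<in> elts (cls w) \<or> cls (\<lambda>x. vset (elts (h x) - elts (a x))) \<in> elts (cls w)"
      unfolding cls_Diff using u by blast
    then show "eventually (\<lambda>x. elts (a x) \<subseteq> elts (h x) \<longrightarrow> a x \<in> elts (w x) \<or> vset (elts (h x) - elts (a x)) \<in> elts (w x)) F"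
      by (simp add: ev_imp ev_disj cls_mem_iff cls_subset_iff)
  qed
  show ?thesis using 1 2 3 4 5 6
  proof eventually_elim
    case (elim x)
    have "\<forall>A\<in>elts (w x). elts A \<subseteq> elts (h x)" using elim(1) by blast
    moreover have "\<forall>A\<in>elts (w x). \<forall>B\<in>elts (w x). vset (elts A \<inter> elts B) \<in> elts (w x)"
      using elim(4) by blast
    moreover have "\<forall>A\<in>elts (w x). \<forall>B\<in>UNIV. elts A \<subseteq> elts B \<and> elts B \<subseteq> elts (h x) \<longrightarrow> B \<in> elts (w x)"
      using elim(5) by blast
    moreover have "\<forall>A\<in>UNIV. elts A \<subseteq> elts (h x) \<longrightarrow> A \<in> elts (w x) \<or> vset (elts (h x) - elts A) \<in> elts (w x)"
      using elim(6) by blast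
    ultimately show ?case unfolding ultrafilter_on_def using elim(2,3) by (intro conjI UNIV_I)
  qed
qed

lemma cc_ultrafilter_cls:
  assumes "cc_ultrafilter_on M (cls w) (cls h)"
  shows "eventually (\<lambda>x. cc_ultrafilter_on UNIV (w x) (h x)) F"
proof -
  have 1: "eventually (\<lambda>x. ultrafilter_on UNIV (w x) (h x)) F"
    by (rule ultrafilter_cls) (use assms in \<open>simp add: cc_ultrafilter_on_def\<close>)
  have 2: "eventually (\<lambda>x. \<forall>s. is_fun s omega \<and> (\<forall>n. app s (vnat n) \<in> elts (w x))
        \<longrightarrow> vset (\<Inter>n\<in>elts omega. elts (app s n)) \<in> elts (w x)) F"
  proof (rule ev_imp_all)
    fix s assume s: "eventually (\<lambda>x. is_fun (s x) omega \<and> (\<forall>n. app (s x) (vnat n) \<in> elts (w x))) F"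
    then have "eventually (\<lambda>x. is_fun (s x) omega) F" by eventually_elim simp
    then have s1: "is_fun (cls s) omega" using is_fun_cls_iff [of s "\<lambda>_. omega"] by simp
    have "app (cls s) (vnat n) \<in> elts (cls w)" for n
    proof -
      have "app (cls s) (vnat n) = cls (\<lambda>x. app (s x) (vnat n))"
        using cls_app [of s "\<lambda>_. omega" "\<lambda>_. vnat n"] s1 by simp
      moreover have "eventually (\<lambda>x. app (s x) (vnat n) \<in> elts (w x)) F"
        using s by eventually_elim simp
      ultimately show ?thesis by (simp add: cls_mem_iff)
    qed
    then have "vset (\<Inter>n\<in>elts omega. elts (app (cls s) n)) \<in> elts (cls w)"
      using assms s1 unfolding cc_ultrafilter_on_def by simp
    then show "eventually (\<lambda>x. vset (\<Inter>n\<in>elts omega. elts (app (s x) n)) \<in> elts (w x)) F"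
      unfolding cls_INT [OF s1, symmetric] cls_mem_iff .
  qed
  show ?thesis using 1 2
    by eventually_elim (simp add: cc_ultrafilter_on_def)
qed

end

section \<open>Ultrapowers of ultrapowers\<close>

text \<open>Fixing a representing function \<open>w\<close> in place of the internal ultrafilter
  itself allows its ultrapower to be studied fibre by fibre: almost every \<open>w x\<close> is a
  countably complete ultrafilter in the universe.\<close>

locale internal_ultra = cc_ultra U for U :: "'v::zfc" +
  fixes w :: "'v \<Rightarrow> 'v"
  assumes internal_cc: "cc_ultrafilter (Ult UNIV U) (ucl U w)"
begin

abbreviation W :: 'v where "W \<equiv> ucl U w"

lemma ev_cc_base: "eventually (\<lambda>x. cc_ultrafilter_on UNIV (w x) (base (w x))) F"
  and base_W: "base W = cls (\<lambda>x. base (w x))"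
proof -
  obtain Y where Y: "cc_ultrafilter_on M W Y" using internal_cc unfolding cc_ultrafilter_def by blast
  then have "Y \<in> M" unfolding cc_ultrafilter_on_def ultrafilter_on_def by simp
  then obtain h where h: "Y = cls h" by (rule M_cases)
  then have ev: "eventually (\<lambda>x. cc_ultrafilter_on UNIV (w x) (h x)) F" using Y cc_ultrafilter_cls by blast
  then have ev': "eventually (\<lambda>x. base (w x) = h x) F" by eventually_elim (rule base_eq)
  show "eventually (\<lambda>x. cc_ultrafilter_on UNIV (w x) (base (w x))) F"
    using ev ev' by eventually_elim simp
  show "base W = cls (\<lambda>x. base (w x))"
    using base_eq [OF Y] h cls_cong [OF ev'] by simp
qed

lemma ev_cc: "eventually (\<lambda>x. cc_ultra (w x)) F"
  using ev_cc_base by eventually_elim (auto simp: cc_ultra_def cc_ultrafilter_def)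

lemma cls_in_ult_funs_W: "cls \<phi> \<in> ult_funs M W \<longleftrightarrow> eventually (\<lambda>x. is_fun (\<phi> x) (base (w x))) F"
  unfolding ult_funs_def base_W by (simp add: is_fun_cls_iff)

lemma ult_funs_W_cases:
  assumes "f \<in> ult_funs M W" obtains \<phi> where "f = cls \<phi>"
proof -
  have "f \<in> M" using assms by (simp add: ult_funs_def)
  then show ?thesis using that by (rule M_cases)
qed

text \<open>Stated for an arbitrary \<open>R\<close> that obeys Los, so that one proof covers
  equality and membership.\<close>

lemma W_Collect_iff:
  assumes f: "cls \<phi> \<in> ult_funs M W" and g: "cls \<gamma> \<in> ult_funs M W"
    and R: "\<And>a b. R (cls a) (cls b) \<longleftrightarrow> eventually (\<lambda>x. R (a x) (b x)) F"
  shows "vset {y \<in> elts (base W). R (app (cls \<phi>) y) (app (cls \<gamma>) y)} \<in> elts W \<longleftrightarrow>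
    eventually (\<lambda>x. vset {y \<in> elts (base (w x)). R (app (\<phi> x) y) (app (\<gamma> x) y)} \<in> elts (w x)) F"
proof -
  have C: "elts (cls (\<lambda>x. vset {y \<in> elts (base (w x)). R (app (\<phi> x) y) (app (\<gamma> x) y)}))
     = {y \<in> elts (cls (\<lambda>x. base (w x))). R (app (cls \<phi>) y) (app (cls \<gamma>) y)}"
  proof (rule cls_Collect)
    fix a assume a: "cls a \<in> elts (cls (\<lambda>x. base (w x)))"
    have "cls (\<lambda>x. app (\<phi> x) (a x)) = app (cls \<phi>) (cls a)" "cls (\<lambda>x. app (\<gamma> x) (a x)) = app (cls \<gamma>) (cls a)"
      using f g a by (auto simp: ult_funs_def base_W intro!: cls_app)
    then show "eventually (\<lambda>x. R (app (\<phi> x) (a x)) (app (\<gamma> x) (a x))) F \<longleftrightarrow>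
        R (app (cls \<phi>) (cls a)) (app (cls \<gamma>) (cls a))"
      by (metis R)
  qed
  have "vset {y \<in> elts (base W). R (app (cls \<phi>) y) (app (cls \<gamma>) y)}
     = cls (\<lambda>x. vset {y \<in> elts (base (w x)). R (app (\<phi> x) y) (app (\<gamma> x) y)})"
    unfolding base_W by (simp only: C [symmetric] vset_elts)
  then show ?thesis by (simp only: cls_mem_iff)
qed

definition rep :: "'v \<Rightarrow> 'v \<Rightarrow> 'v" where
  "rep f = (SOME \<phi>. cls \<phi> = f)"

text \<open>The candidate for the collapse of the internal ultrapower: collapse
  \<open>app (\<phi> x)\<close> in each fibre with respect to \<open>w x\<close>, then take the
  class of the results. By \<open>L_cls\<close> the choice made by \<open>rep\<close> is
  immaterial.\<close>

definition L :: "'v \<Rightarrow> 'v" where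
  "L f = cls (\<lambda>x. ucl (w x) (app (rep f x)))"

lemma L_cls: "L (cls \<phi>) = cls (\<lambda>x. ucl (w x) (app (\<phi> x)))"
proof -
  have "cls (rep (cls \<phi>)) = cls \<phi>" unfolding rep_def by (rule someI [of _ \<phi>]) (rule refl)
  then have "eventually (\<lambda>x. rep (cls \<phi>) x = \<phi> x) F" unfolding cls_eq_iff .
  then show ?thesis unfolding L_def cls_eq_iff by eventually_elim simp
qed

lemma L_eq:
  assumes "f \<in> ult_funs M W" "g \<in> ult_funs M W"
  shows "L f = L g \<longleftrightarrow> vset {y \<in> elts (base W). app f y = app g y} \<in> elts W"
proof -
  obtain \<phi> where f: "f = cls \<phi>" using assms(1) by (rule ult_funs_W_cases)
  obtain \<gamma> where g: "g = cls \<gamma>" using assms(2) by (rule ult_funs_W_cases)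
  have "eventually (\<lambda>x. ucl (w x) (app (\<phi> x)) = ucl (w x) (app (\<gamma> x)) \<longleftrightarrow>
      vset {y \<in> elts (base (w x)). app (\<phi> x) y = app (\<gamma> x) y} \<in> elts (w x)) F"
    using ev_cc by eventually_elim (simp add: cc_ultra.cls_eq_iff cc_ultra.eventually_F)
  then show ?thesis
    using W_Collect_iff [of \<phi> \<gamma> "(=)"] assms unfolding f g L_cls ev_iff cls_eq_iff by blast
qed

lemma L_mem:
  assumes "f \<in> ult_funs M W" "g \<in> ult_funs M W"
  shows "L f \<in> elts (L g) \<longleftrightarrow> vset {y \<in> elts (base W). app f y \<in> elts (app g y)} \<in> elts W"
proof -
  obtain \<phi> where f: "f = cls \<phi>" using assms(1) by (rule ult_funs_W_cases)
  obtain \<gamma> where g: "g = cls \<gamma>" using assms(2) by (rule ult_funs_W_cases)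
  have "eventually (\<lambda>x. ucl (w x) (app (\<phi> x)) \<in> elts (ucl (w x) (app (\<gamma> x))) \<longleftrightarrow>
      vset {y \<in> elts (base (w x)). app (\<phi> x) y \<in> elts (app (\<gamma> x) y)} \<in> elts (w x)) F"
    using ev_cc by eventually_elim (simp add: cc_ultra.cls_mem_iff cc_ultra.eventually_F)
  then show ?thesis
    using W_Collect_iff [of \<phi> \<gamma> "\<lambda>a b. a \<in> elts b"] assms cls_mem_iff
    unfolding f g L_cls ev_iff cls_mem_iff by blast
qed

lemma ucl_cong_base: "(\<And>y. y \<in> elts (base V) \<Longrightarrow> f y = g y) \<Longrightarrow> ucl V f = ucl V g"
  unfolding ucl_def using vlam_cong by metis

text \<open>The witness is recorded explicitly because \<open>ult_class_W_cls\<close> has to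
  evaluate that particular function, whereas the range computations use only its existence.\<close>

lemma cls_ucl_in_L: "\<exists>f\<in>ult_funs M W. cls (\<lambda>x. ucl (w x) (\<psi> x)) = L f \<and> f = cls (\<lambda>x. vlam (base (w x)) (\<psi> x))"
proof -
  have "(\<lambda>x. ucl (w x) (\<psi> x)) = (\<lambda>x. ucl (w x) (app (vlam (base (w x)) (\<psi> x))))"
    by (intro ext ucl_cong_base) simp
  then have "cls (\<lambda>x. ucl (w x) (\<psi> x)) = L (cls (\<lambda>x. vlam (base (w x)) (\<psi> x)))"
    unfolding L_cls by simp
  moreover have "cls (\<lambda>x. vlam (base (w x)) (\<psi> x)) \<in> ult_funs M W"
    unfolding cls_in_ult_funs_W by simp
  ultimately show ?thesis by blast
qed

lemma L_onto:
  assumes "g \<in> ult_funs M W" "z \<in> elts (L g)"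
  shows "\<exists>f\<in>ult_funs M W. z = L f"
proof -
  obtain \<gamma> where g: "g = cls \<gamma>" using assms(1) by (rule ult_funs_W_cases)
  obtain \<zeta> where z: "z = cls \<zeta>" and ev: "eventually (\<lambda>x. \<zeta> x \<in> elts (ucl (w x) (app (\<gamma> x)))) F"
    using assms(2) unfolding g L_cls by (rule elts_cls_cases)
  have "eventually (\<lambda>x. \<exists>\<psi>. \<zeta> x = ucl (w x) \<psi>) F"
    using ev ev_cc by eventually_elim (metis cc_ultra.elts_cls_cases)
  then obtain \<psi> where "eventually (\<lambda>x. \<zeta> x = ucl (w x) (\<psi> x)) F" by (rule ev_choice)
  then have "z = cls (\<lambda>x. ucl (w x) (\<psi> x))" unfolding z by (rule cls_cong)
  then show ?thesis using cls_ucl_in_L by blast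
qed

lemma ult_class_W: "f \<in> ult_funs M W \<Longrightarrow> ult_class M W f = L f"
  by (rule ult_collapse_class [OF L_eq L_mem L_onto])

lemma Ult_W: "Ult M W = L ` ult_funs M W"
  by (rule ult_collapse_Ult [OF L_eq L_mem L_onto])

lemma ult_class_W_cls:
  "ult_class M W (cls (\<lambda>x. vlam (base (w x)) (\<psi> x))) = cls (\<lambda>x. ucl (w x) (\<psi> x))"
  using cls_ucl_in_L [of \<psi>] ult_class_W by metis

text \<open>The internal ultrapower is the ultraproduct of the models \<open>Ult UNIV (w x)\<close>,
  so its elements can be read off fibrewise.\<close>

lemma Ult_W_iff: "z \<in> Ult M W \<longleftrightarrow> (\<exists>\<psi>. z = cls (\<lambda>x. ucl (w x) (\<psi> x)))"
proof
  assume "z \<in> Ult M W"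
  then obtain f where f: "f \<in> ult_funs M W" "z = L f" unfolding Ult_W by blast
  then obtain \<phi> where "f = cls \<phi>" using ult_funs_W_cases by blast
  then have "z = cls (\<lambda>x. ucl (w x) (app (\<phi> x)))" using f L_cls by simp
  then show "\<exists>\<psi>. z = cls (\<lambda>x. ucl (w x) (\<psi> x))" by (intro exI [of _ "\<lambda>x. app (\<phi> x)"])
next
  assume "\<exists>\<psi>. z = cls (\<lambda>x. ucl (w x) (\<psi> x))"
  then obtain \<psi> where "z = cls (\<lambda>x. ucl (w x) (\<psi> x))" by blast
  then show "z \<in> Ult M W" unfolding Ult_W using cls_ucl_in_L [of \<psi>] by blast
qed

lemma ult_emb_W: "ult_emb M W (cls a) = cls (\<lambda>x. ult_emb UNIV (w x) (a x))"
proof -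
  have "vlam (base W) (\<lambda>_. cls a) = cls (\<lambda>x. vlam (base (w x)) (\<lambda>_. a x))"
    unfolding base_W by (rule cls_vlam [symmetric]) (rule refl)
  then have "ult_emb M W (cls a) = cls (\<lambda>x. ucl (w x) (\<lambda>_. a x))"
    unfolding ult_emb_def by (simp add: ult_class_W_cls)
  then show ?thesis by (simp add: ucl_def ult_emb_def)
qed

lemma ult_emb_W_mem_iff:
  assumes "a \<in> M" "b \<in> M"
  shows "ult_emb M W a \<in> elts (ult_emb M W b) \<longleftrightarrow> a \<in> elts b"
proof -
  obtain f g where fg: "a = cls f" "b = cls g" using assms M_cases by metis
  have "eventually (\<lambda>x. ult_emb UNIV (w x) (f x) \<in> elts (ult_emb UNIV (w x) (g x)) \<longleftrightarrow> f x \<in> elts (g x)) F"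
    using ev_cc by eventually_elim (simp add: cc_ultra.emb_eq cc_ultra.cls_mem_iff cc_ultra.F_not_bot)
  then show ?thesis unfolding fg ult_emb_W cls_mem_iff ev_iff .
qed

end

section \<open>Ordinals and cardinals\<close>

lemma Ord_in_Ord: "Ord x \<Longrightarrow> y \<in> elts x \<Longrightarrow> Ord y"
  unfolding Ord_def transitive_def by blast

lemma Ord_trans: "Ord x \<Longrightarrow> y \<in> elts x \<Longrightarrow> z \<in> elts y \<Longrightarrow> z \<in> elts x"
  unfolding Ord_def transitive_def by blast

text \<open>Nested induction on membership: if \<open>a\<close> and \<open>b\<close> were
  incomparable, both hypotheses would make each a subset of the other.\<close>

lemma Ord_linear: "Ord a \<Longrightarrow> Ord b \<Longrightarrow> a \<in> elts b \<or> a = b \<or> b \<in> elts (a::'v::zfc)"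
proof (induction a arbitrary: b rule: mem_induct)
  case (mem a)
  note IHa = mem.IH and a = mem.prems(1)
  show ?case using mem.prems(2)
  proof (induction b rule: mem_induct)
    case (mem b)
    note IHb = mem.IH and b = mem.prems
    show ?case
    proof (rule ccontr)
      assume *: "\<not> ?thesis"
      have "y \<in> elts b" if y: "y \<in> elts a" for y
        using IHa [OF y Ord_in_Ord [OF a y] b] * y Ord_trans [OF a y] by blast
      moreover have "y \<in> elts a" if y: "y \<in> elts b" for y
        using IHb [OF y Ord_in_Ord [OF b y]] * y Ord_trans [OF b y] by blast
      ultimately have "a = b" by (intro extensionality) blast
      then show False using * by blast
    qed
  qed
qed

lemma Ord_subset_cases: "Ord a \<Longrightarrow> Ord b \<Longrightarrow> elts a \<subseteq> elts b \<Longrightarrow> a \<in> elts b \<or> a = b"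
  using Ord_linear [of a b] by auto

lemma Ord_mem_or_subset: "Ord a \<Longrightarrow> Ord b \<Longrightarrow> a \<in> elts b \<or> elts b \<subseteq> elts a"
  using Ord_linear [of a b] unfolding Ord_def transitive_def by blast

lemma Ord_vnat [simp]: "Ord (vnat n :: 'v::zfc)"
proof -
  have *: "elts (vnat n :: 'v) = vnat ` {..<n}" for n
  proof (induction n)
    case (Suc n)
    have "elts (vnat (Suc n) :: 'v) = insert (vnat n) (elts (vnat n))" by simp
    then show ?case using Suc by (simp add: lessThan_Suc del: vnat.simps)
  qed simp
  have "transitive (vnat n :: 'v)" for n
    unfolding transitive_def * using * by auto
  then show ?thesis unfolding Ord_def using * by auto
qed

lemma finite_vnat [simp]: "finite (elts (vnat n))"
  by (induction n) auto

lemma vnat_in_infinite_Ord: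
  assumes "Ord \<kappa>" "infinite (elts \<kappa>)" shows "vnat n \<in> elts \<kappa>"
proof (rule ccontr)
  assume "vnat n \<notin> elts \<kappa>"
  then have "elts \<kappa> \<subseteq> elts (vnat n)" using Ord_mem_or_subset assms(1) Ord_vnat by blast
  then show False using assms(2) finite_vnat finite_subset by blast
qed

text \<open>A well-order of the set, which the logic provides, is collapsed by well-founded
  recursion; the image is an ordinal.\<close>

lemma ex_Ord_eqpoll: "\<exists>\<alpha>::'v. Ord \<alpha> \<and> elts \<alpha> \<approx> elts (x::'v::zfc)"
proof -
  obtain r where r: "well_order_on (elts x) r" using well_order_on by blast
  define R where "R = r - Id"
  have wf: "wf R" using r unfolding well_order_on_def R_def by blast
  have Rx: "y \<in> elts x \<and> z \<in> elts x" if "(y, z) \<in> R" for y z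
    using that r unfolding R_def well_order_on_def linear_order_on_def partial_order_on_def preorder_on_def refl_on_def
    by blast
  have tot: "(y, z) \<in> R \<or> (z, y) \<in> R" if "y \<in> elts x" "z \<in> elts x" "y \<noteq> z" for y z
    using that r unfolding R_def well_order_on_def linear_order_on_def total_on_def by blast
  have tr: "(y, v) \<in> R" if "(y, z) \<in> R" "(z, v) \<in> R" for y z v
    using that r unfolding R_def well_order_on_def linear_order_on_def partial_order_on_def preorder_on_def
    by (auto dest: transD antisymD)
  define \<rho> :: "'v \<Rightarrow> 'v" where "\<rho> = wfrec R (\<lambda>c y. vset (c ` {z. (z, y) \<in> R}))"
  have sm: "small {z. (z, y) \<in> R}" for y
    by (rule small_subset [OF small_elts [of x]]) (use Rx in blast)
  have unf: "elts (\<rho> y) = \<rho> ` {z. (z, y) \<in> R}" for y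
  proof -
    have "\<rho> y = vset (cut \<rho> R y ` {z. (z, y) \<in> R})"
      unfolding \<rho>_def by (subst wfrec [OF wf]) simp
    also have "cut \<rho> R y ` {z. (z, y) \<in> R} = \<rho> ` {z. (z, y) \<in> R}"
      by (rule image_cong) (simp_all add: cut_apply)
    finally show ?thesis using sm by simp
  qed
  have inj: "inj_on \<rho> (elts x)"
  proof (rule inj_onI, rule ccontr)
    fix y z assume yz: "y \<in> elts x" "z \<in> elts x" "\<rho> y = \<rho> z" "y \<noteq> z"
    then have "\<rho> y \<in> elts (\<rho> z) \<or> \<rho> z \<in> elts (\<rho> y)" using tot [of y z] unf by blast
    then show False using yz by simp
  qed
  define \<alpha> where "\<alpha> = vset (\<rho> ` elts x)"
  have \<alpha>: "elts \<alpha> = \<rho> ` elts x" by (simp add: \<alpha>_def)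
  have "transitive (\<rho> y)" for y
    unfolding transitive_def unf using tr unf by blast
  moreover have "transitive \<alpha>" unfolding transitive_def \<alpha> using Rx unf by blast
  ultimately have "Ord \<alpha>" unfolding Ord_def \<alpha> by blast
  moreover have "elts \<alpha> \<approx> elts x"
    unfolding \<alpha> using inj by (rule inj_on_image_eqpoll_self)
  ultimately show ?thesis by blast
qed

lemma Ord_vcard: "Ord (vcard x)" and vcard_eqpoll: "elts (vcard x) \<approx> elts (x::'v::zfc)"
proof -
  let ?P = "\<lambda>\<alpha>::'v. Ord \<alpha> \<and> elts \<alpha> \<approx> elts x \<and> (\<forall>\<beta>\<in>elts \<alpha>. \<not> elts \<beta> \<approx> elts x)"
  obtain \<alpha> :: 'v where "Ord \<alpha> \<and> elts \<alpha> \<approx> elts x" using ex_Ord_eqpoll by blast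
  then obtain m :: 'v where m: "Ord m \<and> elts m \<approx> elts x" "\<And>y. y \<in> elts m \<Longrightarrow> \<not> (Ord y \<and> elts y \<approx> elts x)"
    using mem_minimal [of "\<lambda>\<alpha>::'v. Ord \<alpha> \<and> elts \<alpha> \<approx> elts x"] by blast
  have "?P (vcard x)" unfolding vcard_def
  proof (rule theI [of ?P m])
    show "?P m" using m Ord_in_Ord by blast
    show "\<beta> = m" if "?P \<beta>" for \<beta>
      using that m Ord_linear [of \<beta> m] by blast
  qed
  then show "Ord (vcard x)" "elts (vcard x) \<approx> elts x" by blast+
qed

section \<open>Ordinals and the ultrapower embedding\<close>

context cc_ultra
begin

lemma transitive_cls: "eventually (\<lambda>x. transitive (f x)) F \<Longrightarrow> transitive (cls f)"
  unfolding transitive_def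
proof
  fix y assume f: "eventually (\<lambda>x. \<forall>y\<in>elts (f x). elts y \<subseteq> elts (f x)) F" and "y \<in> elts (cls f)"
  then obtain g where g: "y = cls g" "eventually (\<lambda>x. g x \<in> elts (f x)) F" by (blast elim: elts_cls_cases)
  have "eventually (\<lambda>x. elts (g x) \<subseteq> elts (f x)) F" using f g(2) by eventually_elim blast
  then show "elts y \<subseteq> elts (cls f)" unfolding g cls_subset_iff .
qed

lemma Ord_cls: 
  assumes "eventually (\<lambda>x. Ord (f x)) F" shows "Ord (cls f)"
  unfolding Ord_def
proof
  show "transitive (cls f)"
    by (rule transitive_cls) (use assms in eventually_elim, simp add: Ord_def)
  show "\<forall>y\<in>elts (cls f). transitive y"
  proof
    fix y assume "y \<in> elts (cls f)"
    then obtain g where g: "y = cls g" "eventually (\<lambda>x. g x \<in> elts (f x)) F" by (blast elim: elts_cls_cases)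
    have "eventually (\<lambda>x. transitive (g x)) F" using assms g(2) by eventually_elim (simp add: Ord_def)
    then show "transitive y" unfolding g by (rule transitive_cls)
  qed
qed

lemma emb_mem_iff: "ult_emb UNIV U x \<in> elts (ult_emb UNIV U y) \<longleftrightarrow> x \<in> elts y"
  by (simp add: emb_eq cls_mem_iff)

text \<open>Otherwise every ordinal is fixed, since by induction it is included in its image but not
  an element of it. An injection of \<open>X\<close> into an ordinal \<open>\<delta>\<close> then
  represents an ordinal below \<open>\<delta>\<close>, which is fixed too. So the injection is
  constant almost everywhere, and \<open>U\<close> is principal.\<close>

lemma ex_moved:
  assumes np: "nonprincipal U"
  shows "\<exists>\<kappa>. \<kappa> \<in> elts (ult_emb UNIV U \<kappa>) "
proof (rule ccontr)
  assume none: "\<not> ?thesis"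
  have fixed: "ult_emb UNIV U \<alpha> = \<alpha>" if "Ord \<alpha>" for \<alpha>
    using that
  proof (induction \<alpha> rule: mem_induct)
    case (mem \<alpha>)
    have "\<beta> \<in> elts (ult_emb UNIV U \<alpha>)" if "\<beta> \<in> elts \<alpha>" for \<beta>
      using mem.IH [OF that Ord_in_Ord [OF mem.prems that]] emb_mem_iff [of \<beta> \<alpha>] that by simp
    then have "elts \<alpha> \<subseteq> elts (ult_emb UNIV U \<alpha>)" by blast
    moreover have "Ord (ult_emb UNIV U \<alpha>)" unfolding emb_eq by (rule Ord_cls) (simp add: mem.prems)
    ultimately show ?case using Ord_subset_cases [of \<alpha> "ult_emb UNIV U \<alpha>"] mem.prems none by metis
  qed
  obtain \<delta> :: 'v where \<delta>: "Ord \<delta>" "elts \<delta> \<approx> elts X" using ex_Ord_eqpoll by blast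
  then obtain h where h: "bij_betw h (elts X) (elts \<delta>)" using eqpoll_sym eqpoll_def by blast
  have "eventually (\<lambda>x. h x \<in> elts \<delta>) F"
    using ev_base by eventually_elim (use h in \<open>auto simp: bij_betw_def\<close>)
  then have "cls h \<in> elts (ult_emb UNIV U \<delta>)" by (simp add: emb_eq cls_mem_iff)
  then have "cls h \<in> elts \<delta>" using fixed \<delta>(1) by simp
  then have "ult_emb UNIV U (cls h) = cls h" using fixed Ord_in_Ord \<delta>(1) by blast
  then have ev: "eventually (\<lambda>x. h x = cls h) F" by (simp add: emb_eq cls_eq_iff eq_commute)
  obtain x where x: "x \<in> elts X" "h x = cls h" using ev ev_witness by blast
  have "eventually (\<lambda>y. y \<in> elts (vset {x})) F"
    using ev ev_base by eventually_elim (use h x in \<open>auto simp: bij_betw_def inj_on_def\<close>)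
  then have "vset {x} \<in> elts U" using x by (simp add: mem_U_iff)
  then show False using np x unfolding nonprincipal_def by blast
qed

end

text \<open>The argument of Suzuki: \<open>\<kappa>\<close> and \<open>U\<close> are represented by functions whose values
  form a counterexample with a smaller \<open>\<kappa>\<close>.\<close>

lemma Ult_UNIV_fixes:
  assumes "cc_ultrafilter UNIV U" "Ult UNIV U = UNIV"
  shows "\<kappa> \<notin> elts (ult_emb UNIV U (\<kappa> :: 'v::zfc))"
proof
  assume "\<kappa> \<in> elts (ult_emb UNIV U \<kappa>)"
  let ?Q = "\<lambda>\<kappa>. \<exists>U. cc_ultrafilter UNIV U \<and> Ult UNIV U = UNIV \<and> \<kappa> \<in> elts (ult_emb UNIV U (\<kappa> :: 'v))"
  have "?Q \<kappa>" using assms \<open>\<kappa> \<in> elts (ult_emb UNIV U \<kappa>)\<close> by blast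
  then obtain \<mu> where "?Q \<mu>" and minimal: "\<And>y. y \<in> elts \<mu> \<Longrightarrow> \<not> ?Q y"
    using mem_minimal [of ?Q] by blast
  then obtain D where D: "cc_ultrafilter UNIV D" "Ult UNIV D = UNIV" "\<mu> \<in> elts (ult_emb UNIV D \<mu>)" by blast
  interpret cc_ultra D by unfold_locales (rule D)
  obtain w where w: "D = cls w" using D(2) M_cases UNIV_I by metis
  obtain g where g: "\<mu> = cls g" using D(2) M_cases UNIV_I by metis
  interpret internal_ultra D w by unfold_locales (use D w in simp)
  \<comment> \<open>As \<open>M\<close> is the universe and \<open>w\<close> represents
    \<open>D\<close>, the internal ultrapower is again that of \<open>D\<close>. Hence both its
    embedding and the equation \<open>Ult UNIV D = UNIV\<close> can be read in the fibres.\<close>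
  have "eventually (\<lambda>x. g x \<in> elts (ult_emb UNIV (w x) (g x))) F"
    using D(3) ult_emb_W [of g] unfolding D(2) w [symmetric] g [symmetric] by (simp add: g cls_mem_iff)
  moreover have "eventually (\<lambda>x. \<forall>y. y \<in> Ult UNIV (w x)) F"
  proof (rule ev_all)
    fix y
    have "cls y \<in> Ult M W" unfolding D(2) w [symmetric] by simp
    then obtain \<psi> where "cls y = cls (\<lambda>x. ucl (w x) (\<psi> x))" unfolding Ult_W_iff by blast
    then have "eventually (\<lambda>x. y x = ucl (w x) (\<psi> x)) F" unfolding cls_eq_iff .
    then show "eventually (\<lambda>x. y x \<in> Ult UNIV (w x)) F"
      using ev_cc by eventually_elim (simp add: cc_ultra.cls_in_M)
  qed
  \<comment> \<open>The same membership is used a second time, with only its left side written as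
    \<open>cls g\<close>: this places the values \<open>g x\<close> below the minimal
    \<open>\<mu>\<close>.\<close>
  moreover have "eventually (\<lambda>x. g x \<in> elts \<mu>) F"
    using D(3) unfolding emb_eq by (simp add: g cls_mem_iff)
  ultimately have "eventually (\<lambda>x. g x \<in> elts \<mu> \<and> ?Q (g x)) F"
    using ev_cc by eventually_elim (auto simp: cc_ultra_def)
  then obtain x where "g x \<in> elts \<mu>" "?Q (g x)" by (rule ev_witness) blast
  then show False using minimal by blast
qed

section \<open>Irreflexivity of the Mitchell order\<close>

lemma ultrafilter_on_subclass:
  assumes "ultrafilter_on UNIV U X" "U \<in> N" "X \<in> N" shows "ultrafilter_on N U X"
proof -
  note u = assms(1) [unfolded ultrafilter_on_def]
  have "\<forall>A\<in>elts U. \<forall>B\<in>UNIV. elts A \<subseteq> elts B \<and> elts B \<subseteq> elts X \<longrightarrow> B \<in> elts U" using u by (elim conjE)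
  then have 1: "\<forall>A\<in>elts U. \<forall>B\<in>N. elts A \<subseteq> elts B \<and> elts B \<subseteq> elts X \<longrightarrow> B \<in> elts U" by blast
  have "\<forall>A\<in>UNIV. elts A \<subseteq> elts X \<longrightarrow> A \<in> elts U \<or> vset (elts X - elts A) \<in> elts U" using u by (elim conjE)
  then have 2: "\<forall>A\<in>N. elts A \<subseteq> elts X \<longrightarrow> A \<in> elts U \<or> vset (elts X - elts A) \<in> elts U" by blast
  show ?thesis using u 1 2 assms(2,3) unfolding ultrafilter_on_def by (elim conjE) (intro conjI)
qed

lemma cc_ultrafilter_on_subclass:
  assumes "cc_ultrafilter_on UNIV U X" "U \<in> N" "X \<in> N" shows "cc_ultrafilter_on N U X"
proof -
  have "ultrafilter_on N U X" using assms ultrafilter_on_subclass unfolding cc_ultrafilter_on_def by blast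
  moreover have "\<forall>s\<in>N. is_fun s omega \<and> (\<forall>n\<in>elts omega. app s n \<in> elts U)
        \<longrightarrow> vset (\<Inter>n\<in>elts omega. elts (app s n)) \<in> elts U"
    using assms(1) unfolding cc_ultrafilter_on_def by blast
  ultimately show ?thesis unfolding cc_ultrafilter_on_def by (intro conjI)
qed

context cc_ultra
begin

lemma cc_internal:
  assumes "U \<in> M" shows "cc_ultrafilter M U"
proof -
  have "X \<in> elts U" using mem_U_iff ev_base by simp
  then have "X \<in> M" using assms M_trans by blast
  then have "cc_ultrafilter_on M U X"
    using cc_on assms cc_ultrafilter_on_subclass by blast
  then show ?thesis unfolding cc_ultrafilter_def by blast
qed

text \<open>Induction on the collapsed value. Whatever lies below the class of \<open>h\<close> is
  represented by a function with values in elements of the \<open>h x\<close>, hence in the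
  transitive class \<open>T\<close>; as \<open>M\<close> contains such functions, both ultrapowers
  see the same elements.\<close>

lemma internal_ultrapower_agrees:
  assumes U: "U \<in> M" and T: "\<And>x y. x \<in> T \<Longrightarrow> y \<in> elts x \<Longrightarrow> y \<in> T"
    and funs: "\<And>h. (\<And>x. x \<in> elts X \<Longrightarrow> h x \<in> T) \<Longrightarrow> vlam X h \<in> M"
    and h: "\<And>x. x \<in> elts X \<Longrightarrow> h x \<in> T"
  shows "cls h = ult_class M U (vlam X h)"
proof -
  obtain w where w: "U = cls w" using U by (rule M_cases)
  interpret internal_ultra U w by unfold_locales (use cc_internal [OF U] w in simp)
  have W: "W = U" using w by simp
  have vl: "vlam X g \<in> ult_funs M U" if "\<forall>x\<in>elts X. g x \<in> T" for g
    using funs that by (simp add: ult_funs_def)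
  have Lvl: "ult_class M U (vlam X g) = L (vlam X g)" if "\<forall>x\<in>elts X. g x \<in> T" for g
    using ult_class_W [of "vlam X g"] vl [OF that] unfolding W .
  have *: "z = cls h \<Longrightarrow> z = L (vlam X h)" if "\<forall>x\<in>elts X. h x \<in> T" for z h
    using that
  proof (induction z arbitrary: h rule: mem_induct)
    case (mem z)
    note z = mem.prems(1) and hT = mem.prems(2)
    have step: "\<exists>g'. (\<forall>x\<in>elts X. g' x \<in> T) \<and> cls g' = cls g \<and> cls g' \<in> elts (cls h) \<and>
        L (vlam X g') \<in> elts (L (vlam X h)) \<and> cls g' = L (vlam X g') \<and>
        eventually (\<lambda>x. g' x = g x) F"
      if g: "eventually (\<lambda>x. g x \<in> elts (h x)) F" for g
    proof -
      \<comment> \<open>The default \<open>h x\<close> keeps the values in \<open>T\<close> at the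
        exceptional points, so that the restriction of \<open>g'\<close> to \<open>X\<close> belongs
        to \<open>M\<close>.\<close>
      define g' where "g' = (\<lambda>x. if g x \<in> elts (h x) then g x else h x)"
      have T': "\<forall>x\<in>elts X. g' x \<in> T"
        using hT T unfolding g'_def by auto
      have ev: "eventually (\<lambda>x. g' x = g x) F" using g by eventually_elim (simp add: g'_def)
      have ev': "eventually (\<lambda>x. g' x \<in> elts (h x)) F" using g by eventually_elim (simp add: g'_def)
      then have m: "cls g' \<in> elts (cls h)" by (simp add: cls_mem_iff)
      have "eventually (\<lambda>x. app (vlam X g') x \<in> elts (app (vlam X h) x)) F"
        using ev' ev_base by eventually_elim simp
      then have "L (vlam X g') \<in> elts (L (vlam X h))"
        using L_mem [of "vlam X g'" "vlam X h"] vl [OF T'] vl [OF hT] unfolding W eventually_F by blast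
      moreover have "cls g' = L (vlam X g')"
        using mem.IH [of "cls g'" g'] m T' z by blast
      ultimately show ?thesis using T' m ev cls_cong [OF ev] by blast
    qed
    have "elts (cls h) = elts (L (vlam X h))"
    proof (intro set_eqI iffI)
      fix y assume "y \<in> elts (cls h)"
      then obtain g where "y = cls g" "eventually (\<lambda>x. g x \<in> elts (h x)) F" by (rule elts_cls_cases)
      then show "y \<in> elts (L (vlam X h))" using step by metis
    next
      fix y assume y: "y \<in> elts (L (vlam X h))"
      obtain f where f: "f \<in> ult_funs M U" "y = L f"
        using L_onto [of "vlam X h" y] vl [OF hT] y unfolding W by blast
      have "eventually (\<lambda>x. app f x \<in> elts (app (vlam X h) x)) F"
        using L_mem [of f "vlam X h"] f vl [OF hT] y unfolding W eventually_F by blast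
      then have "eventually (\<lambda>x. app f x \<in> elts (h x)) F" using ev_base by eventually_elim simp
      then obtain g' where g': "\<forall>x\<in>elts X. g' x \<in> T" "cls g' \<in> elts (cls h)" "cls g' = L (vlam X g')"
          "eventually (\<lambda>x. g' x = app f x) F"
        using step [of "app f"] by blast
      have "eventually (\<lambda>x. app (vlam X g') x = app f x) F" using g'(4) ev_base by eventually_elim simp
      then have "L (vlam X g') = L f"
        using L_eq [of "vlam X g'" f] f(1) vl [of g'] g'(1) unfolding W eventually_F by blast
      then show "y \<in> elts (cls h)" using g' f by simp
    qed
    then show ?case using z extensionality by blast
  qed
  have "\<forall>x\<in>elts X. h x \<in> T" using h by blast
  then show ?thesis using * [OF _ refl] Lvl by simp
qed

lemma internal_emb_agrees:
  assumes "U \<in> M" "\<And>x y. x \<in> T \<Longrightarrow> y \<in> elts x \<Longrightarrow> y \<in> T"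
    and "\<And>h. (\<And>x. x \<in> elts X \<Longrightarrow> h x \<in> T) \<Longrightarrow> vlam X h \<in> M" and "t \<in> T"
  shows "ult_emb UNIV U t = ult_emb M U t"
  using internal_ultrapower_agrees [of T "\<lambda>_. t"] assms by (simp add: ucl_def ult_emb_def)

text \<open>Agreement of the two embeddings on \<open>X\<close> makes \<open>M\<close> closed under
  \<open>X\<close>-sequences; closure extends the agreement to all of \<open>M\<close>; and with its
  own copy of the embedding \<open>M\<close> can define every set \<open>a\<close> from the image of
  \<open>a\<close>.\<close>

lemma Ult_eq_UNIV:
  assumes U: "U \<in> M" and T: "\<And>x y. x \<in> T \<Longrightarrow> y \<in> elts x \<Longrightarrow> y \<in> T" and XT: "elts X \<subseteq> T"
    and funs: "\<And>h. (\<And>x. x \<in> elts X \<Longrightarrow> h x \<in> T) \<Longrightarrow> vlam X h \<in> M"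
  shows "M = UNIV"
proof -
  obtain w where w: "U = cls w" using U by (rule M_cases)
  interpret internal_ultra U w by unfold_locales (use cc_internal [OF U] w in simp)
  have W: "W = U" using w by simp
  have on_X: "ult_emb UNIV U x = ult_emb M U x" if "x \<in> elts X" for x
    by (rule internal_emb_agrees [OF U T funs]) (use that XT in auto)
  have closed: "vlam X h \<in> M" if hM: "\<And>y. y \<in> elts X \<Longrightarrow> h y \<in> M" for h
  proof -
    \<comment> \<open>\<open>cls H\<close> is a function whose value at the image of
      \<open>y\<close> is \<open>h y\<close>. Composing it with the embedding of \<open>X\<close>,
      which \<open>M\<close> computes as the class of the maps \<open>ult_emb UNIV (w x)\<close>,
      gives back \<open>h\<close>.\<close>
    define H where "H = (\<lambda>x. vlam X (\<lambda>y. rep (h y) x))"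
    have "cls (\<lambda>x. app (H x) (ult_emb UNIV (w x) (a x))) = h (cls a)"
      if "cls a \<in> elts (cls (\<lambda>x. base (w x)))" for a
    proof -
      have a: "cls a \<in> elts X" using that base_W unfolding W by simp
      have "cls (\<lambda>x. ult_emb UNIV (w x) (a x)) = cls (\<lambda>_. cls a)"
        using on_X [OF a] ult_emb_W [of a] unfolding W emb_eq by simp
      then have "eventually (\<lambda>x. ult_emb UNIV (w x) (a x) = cls a) F" unfolding cls_eq_iff .
      then have "eventually (\<lambda>x. app (H x) (ult_emb UNIV (w x) (a x)) = rep (h (cls a)) x) F"
        by eventually_elim (simp add: H_def a)
      moreover have "cls (rep (h (cls a))) = h (cls a)"
        using hM [OF a] unfolding rep_def by (metis (mono_tags) M_cases someI_ex)
      ultimately show ?thesis using cls_cong by metis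
    qed
    then have "cls (\<lambda>x. vlam (base (w x)) (\<lambda>z. app (H x) (ult_emb UNIV (w x) z))) = vlam (cls (\<lambda>x. base (w x))) h"
      by (rule cls_vlam)
    then show ?thesis using base_W unfolding W by (metis cls_in_M)
  qed
  \<comment> \<open>By \<open>closed\<close>, the class \<open>M\<close> itself can now play the
    role of \<open>T\<close>.\<close>
  have J: "ult_emb UNIV U t = ult_emb M U t" if "t \<in> M" for t
    by (rule internal_emb_agrees [OF U M_trans closed that])
  have "a \<in> M" for a
  proof (induction a rule: mem_induct)
    case (mem a)
    \<comment> \<open>\<open>cls c\<close> includes \<open>a\<close>, which is a subset of
      \<open>M\<close> by induction. It bounds the separation that recovers \<open>a\<close> as the
      set of those \<open>z\<close> whose image lies in the image of \<open>a\<close>.\<close>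
    define c where "c = (\<lambda>x. vset ((\<lambda>y. rep y x) ` elts a))"
    have "elts (cls (\<lambda>x. vset {z \<in> elts (c x). ult_emb UNIV (w x) z \<in> elts a})) = elts a"
    proof (rule elts_cls_eqI)
      fix f
      have "eventually (\<lambda>x. ult_emb UNIV (w x) (f x) \<in> elts a) F \<longleftrightarrow> ult_emb M U (cls f) \<in> elts (ult_emb UNIV U a)"
        using ult_emb_W [of f] unfolding W emb_eq by (simp add: cls_mem_iff)
      also have "\<dots> \<longleftrightarrow> cls f \<in> elts a" using J [of "cls f", symmetric] emb_mem_iff by simp
      finally have 1: "eventually (\<lambda>x. ult_emb UNIV (w x) (f x) \<in> elts a) F \<longleftrightarrow> cls f \<in> elts a" .
      have 2: "eventually (\<lambda>x. f x \<in> elts (c x)) F" if "cls f \<in> elts a"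
      proof -
        have "cls (rep (cls f)) = cls f" unfolding rep_def by (rule someI [of _ f]) (rule refl)
        then have "eventually (\<lambda>x. rep (cls f) x = f x) F" unfolding cls_eq_iff .
        then show ?thesis by eventually_elim (use that in \<open>auto simp: c_def intro!: image_eqI [of _ _ "cls f"]\<close>)
      qed
      show "eventually (\<lambda>x. f x \<in> elts (vset {z \<in> elts (c x). ult_emb UNIV (w x) z \<in> elts a})) F \<longleftrightarrow> cls f \<in> elts a"
        using 1 2 by (auto simp: eventually_conj_iff)
    next
      show "elts a \<subseteq> M" using mem.IH by blast
    qed
    then have "cls (\<lambda>x. vset {z \<in> elts (c x). ult_emb UNIV (w x) z \<in> elts a}) = a"
      by (rule extensionality)
    then show ?case by (rule subst) (rule cls_in_M)
  qed
  then show ?thesis by blast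
qed

lemma Mitchell_irreflexive:
  assumes "nonprincipal U" "\<And>x y. x \<in> T \<Longrightarrow> y \<in> elts x \<Longrightarrow> y \<in> T" "elts X \<subseteq> T"
    and "\<And>h. (\<And>x. x \<in> elts X \<Longrightarrow> h x \<in> T) \<Longrightarrow> vlam X h \<in> M"
  shows "U \<notin> M"
proof
  assume "U \<in> M"
  then have "M = UNIV" using assms(2-4) by (rule Ult_eq_UNIV)
  then show False using Ult_UNIV_fixes [OF cc] ex_moved [OF assms(1)] by blast
qed

end

section \<open>Internal relations\<close>

lemma infinite_Times_lepoll: "infinite A \<Longrightarrow> A \<times> A \<lesssim> A"
  using card_of_Times_same_infinite [of A] by (simp add: eqpoll_imp_lepoll eqpoll_iff_card_of_ordIso)

context cc_ultra
begin

text \<open>When \<open>A\<close> and \<open>B\<close> are the sets of elements of members of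
  \<open>M\<close>, this says that \<open>M\<close> contains the restriction of \<open>R\<close> to
  \<open>A \<times> B\<close>. The family \<open>P\<close> of pointwise relations spares the coding
  by sets of pairs.\<close>

definition internal_rel :: "'v set \<Rightarrow> 'v set \<Rightarrow> ('v \<Rightarrow> 'v \<Rightarrow> bool) \<Rightarrow> bool" where
  "internal_rel A B R \<longleftrightarrow> (\<exists>P. \<forall>f g. cls f \<in> A \<longrightarrow> cls g \<in> B \<longrightarrow>
      (R (cls f) (cls g) \<longleftrightarrow> eventually (\<lambda>x. P x (f x) (g x)) F))"

definition all_internal :: "'v set \<Rightarrow> 'v set \<Rightarrow> bool" where
  "all_internal A B \<longleftrightarrow> (\<forall>R. internal_rel A B R)"

lemma all_internalE:
  assumes "all_internal A B"
  obtains P where "\<forall>f g. cls f \<in> A \<longrightarrow> cls g \<in> B \<longrightarrow>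
      (R (cls f) (cls g) \<longleftrightarrow> eventually (\<lambda>x. P x (f x) (g x)) F)"
  using assms unfolding all_internal_def internal_rel_def by blast

lemma all_internalI:
  assumes "\<And>R. \<exists>P. \<forall>f g. cls f \<in> A \<longrightarrow> cls g \<in> B \<longrightarrow>
      (R (cls f) (cls g) \<longleftrightarrow> eventually (\<lambda>x. P x (f x) (g x)) F)"
  shows "all_internal A B"
  unfolding all_internal_def internal_rel_def using assms by blast

lemma cls_Un: "cls (\<lambda>x. vset (elts (a x) \<union> elts (b x))) = vset (elts (cls a) \<union> elts (cls b))"
proof (rule extensionality)
  have "elts (cls (\<lambda>x. vset (elts (a x) \<union> elts (b x)))) = elts (cls a) \<union> elts (cls b)"
    by (rule elts_cls_eqI) (use M_trans [OF cls_in_M] in \<open>auto simp: cls_mem_iff ev_disj\<close>)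
  then show "elts (cls (\<lambda>x. vset (elts (a x) \<union> elts (b x)))) = elts (vset (elts (cls a) \<union> elts (cls b)))"
    by simp
qed

lemma Un_in_M: "a \<in> M \<Longrightarrow> b \<in> M \<Longrightarrow> vset (elts a \<union> elts b) \<in> M"
  by (elim M_cases) (simp flip: cls_Un)

text \<open>Membership in \<open>a\<close> is itself represented pointwise, so the two
  representations can be joined by a case distinction in each fibre.\<close>

lemma all_internal_Un:
  assumes a: "a \<in> M" and ia: "all_internal C (elts a)" and ib: "all_internal C (elts b)"
  shows "all_internal C (elts (vset (elts a \<union> elts b)))"
proof (rule all_internalI)
  fix R
  obtain h where h: "a = cls h" using a by (rule M_cases)
  obtain P where P [rule_format]: "\<forall>f g. cls f \<in> C \<longrightarrow> cls g \<in> elts a \<longrightarrow>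
      (R (cls f) (cls g) \<longleftrightarrow> eventually (\<lambda>x. P x (f x) (g x)) F)" using ia by (rule all_internalE [where R = R])
  obtain Q where Q [rule_format]: "\<forall>f g. cls f \<in> C \<longrightarrow> cls g \<in> elts b \<longrightarrow>
      (R (cls f) (cls g) \<longleftrightarrow> eventually (\<lambda>x. Q x (f x) (g x)) F)" using ib by (rule all_internalE [where R = R])
  have "R (cls f) (cls g) \<longleftrightarrow>
      eventually (\<lambda>x. g x \<in> elts (h x) \<and> P x (f x) (g x) \<or> g x \<notin> elts (h x) \<and> Q x (f x) (g x)) F"
    if "cls f \<in> C" "cls g \<in> elts a \<union> elts b" for f g
    using that P [of f g] Q [of f g] by (auto simp: ev_disj eventually_conj_iff h cls_mem_iff)
  then show "\<exists>P. \<forall>f g. cls f \<in> C \<longrightarrow> cls g \<in> elts (vset (elts a \<union> elts b)) \<longrightarrow>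
      (R (cls f) (cls g) \<longleftrightarrow> eventually (\<lambda>x. P x (f x) (g x)) F)"
    by (intro exI [of _ "\<lambda>x y z. z \<in> elts (h x) \<and> P x y z \<or> z \<notin> elts (h x) \<and> Q x y z"]) simp
qed

text \<open>The graph of \<open>h\<close> is internal; in each fibre a value related to the argument
  is chosen, and almost everywhere it is the right one.\<close>

lemma vlam_in_M:
  assumes "Y \<in> M" "T \<in> M" and int: "all_internal (elts Y) (elts T)"
    and h: "\<And>y. y \<in> elts Y \<Longrightarrow> h y \<in> elts T"
  shows "vlam Y h \<in> M"
proof -
  obtain \<xi> where \<xi>: "Y = cls \<xi>" using assms(1) by (rule M_cases)
  obtain \<tau> where \<tau>: "T = cls \<tau>" using assms(2) by (rule M_cases)
  obtain P where P [rule_format]: "\<forall>f g. cls f \<in> elts Y \<longrightarrow> cls g \<in> elts T \<longrightarrow>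
      (h (cls f) = cls g \<longleftrightarrow> eventually (\<lambda>x. P x (f x) (g x)) F)"
    using int by (rule all_internalE [where R = "\<lambda>y z. h y = z"])
  define H where "H = (\<lambda>x z. SOME y. y \<in> elts (\<tau> x) \<and> P x z y)"
  have "cls (\<lambda>x. H x (a x)) = h (cls a)" if a: "cls a \<in> elts (cls \<xi>)" for a
  proof -
    have hT: "h (cls a) \<in> elts T" using h a \<xi> by simp
    then obtain g where g: "h (cls a) = cls g" using \<tau> by (blast elim: elts_cls_cases)
    have "eventually (\<lambda>x. P x (a x) (g x)) F" using P [of a g] a g hT \<xi> by simp
    moreover have "eventually (\<lambda>x. g x \<in> elts (\<tau> x)) F" using hT g \<tau> by (simp add: cls_mem_iff)
    ultimately have "eventually (\<lambda>x. H x (a x) \<in> elts (\<tau> x) \<and> P x (a x) (H x (a x))) F"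
    proof eventually_elim
      case (elim x)
      then show ?case unfolding H_def by (intro someI [of "\<lambda>y. y \<in> elts (\<tau> x) \<and> P x (a x) y" "g x"]) simp
    qed
    then have "cls (\<lambda>x. H x (a x)) \<in> elts T" "eventually (\<lambda>x. P x (a x) (H x (a x))) F"
      by (simp_all add: \<tau> cls_mem_iff eventually_conj_iff)
    then show ?thesis using P [of a "\<lambda>x. H x (a x)"] a \<xi> by simp
  qed
  then have "cls (\<lambda>x. vlam (\<xi> x) (H x)) = vlam (cls \<xi>) h" by (rule cls_vlam)
  then have "vlam (cls \<xi>) h \<in> M" by (rule subst) (rule cls_in_M)
  then show ?thesis using \<xi> by simp
qed

end

section \<open>Models containing all subsets of an infinite set\<close>

locale many_subsets = cc_ultra U for U :: "'v::zfc" +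
  fixes \<theta> :: 'v
  assumes vnat_\<theta>: "vnat n \<in> elts \<theta>"
    and Pow_\<theta>: "elts A \<subseteq> elts \<theta> \<Longrightarrow> A \<in> Ult UNIV U"
begin

lemma \<theta>_M: "\<theta> \<in> M"
  using Pow_\<theta> by blast

lemma infinite_\<theta>: "infinite (elts \<theta>)"
proof -
  have "range (vnat :: nat \<Rightarrow> 'v) \<subseteq> elts \<theta>" using vnat_\<theta> by blast
  then show ?thesis using inj_vnat finite_subset range_inj_infinite by blast
qed

text \<open>Almost every fibre of \<open>\<theta>\<close> contains all numerals, by countable
  completeness, and so admits an injective pairing. The class of these pairings is an injective
  pairing on \<open>\<theta>\<close> inside \<open>M\<close>, and it codes a relation as a subset of
  \<open>\<theta>\<close>.\<close>

lemma all_internal_\<theta>: "all_internal (elts \<theta>) (elts \<theta>)"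
proof (rule all_internalI)
  fix R :: "'v \<Rightarrow> 'v \<Rightarrow> bool"
  obtain t where t: "\<theta> = cls t" using \<theta>_M by (rule M_cases)
  have "eventually (\<lambda>x. vnat n \<in> elts (t x)) F" for n
    using vnat_\<theta> [of n] cls_mem_iff [of "\<lambda>_. vnat n" t] by (simp add: t)
  then have "eventually (\<lambda>x. \<forall>n. vnat n \<in> elts (t x)) F" by (rule ev_countable)
  then have "eventually (\<lambda>x. \<exists>p. inj_on p (elts (t x) \<times> elts (t x)) \<and> p ` (elts (t x) \<times> elts (t x)) \<subseteq> elts (t x)) F"
  proof eventually_elim
    case (elim x)
    then have "range (vnat :: nat \<Rightarrow> 'v) \<subseteq> elts (t x)" by blast
    then have "infinite (elts (t x))" using inj_vnat finite_subset range_inj_infinite by blast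
    then show ?case using infinite_Times_lepoll unfolding lepoll_def by blast
  qed
  then obtain p where p: "eventually (\<lambda>x. inj_on (p x) (elts (t x) \<times> elts (t x)) \<and>
      p x ` (elts (t x) \<times> elts (t x)) \<subseteq> elts (t x)) F"
    by (rule ev_choice)
  define pr where "pr = (\<lambda>f g. cls (\<lambda>x. p x (f x, g x)))"
  have pr_mem: "pr f g \<in> elts \<theta>" if "cls f \<in> elts \<theta>" "cls g \<in> elts \<theta>" for f g
  proof -
    have "eventually (\<lambda>x. f x \<in> elts (t x)) F" "eventually (\<lambda>x. g x \<in> elts (t x)) F"
      using that by (simp_all add: t cls_mem_iff)
    then have "eventually (\<lambda>x. p x (f x, g x) \<in> elts (t x)) F"
      using p by eventually_elim blast
    then show ?thesis by (simp add: pr_def t cls_mem_iff)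
  qed
  have pr_inj: "cls f = cls f' \<and> cls g = cls g'"
    if "cls f \<in> elts \<theta>" "cls g \<in> elts \<theta>" "cls f' \<in> elts \<theta>" "cls g' \<in> elts \<theta>" "pr f g = pr f' g'" for f g f' g'
  proof -
    have "eventually (\<lambda>x. f x \<in> elts (t x)) F" "eventually (\<lambda>x. g x \<in> elts (t x)) F"
      "eventually (\<lambda>x. f' x \<in> elts (t x)) F" "eventually (\<lambda>x. g' x \<in> elts (t x)) F"
      "eventually (\<lambda>x. p x (f x, g x) = p x (f' x, g' x)) F"
      using that by (simp_all add: t cls_mem_iff pr_def cls_eq_iff)
    then have "eventually (\<lambda>x. f x = f' x \<and> g x = g' x) F"
      using p by eventually_elim (auto dest: inj_onD)
    then show ?thesis by (simp add: cls_eq_iff eventually_conj_iff)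
  qed
  define A where "A = vset {y \<in> elts \<theta>. \<exists>f g. cls f \<in> elts \<theta> \<and> cls g \<in> elts \<theta> \<and> R (cls f) (cls g) \<and> y = pr f g}"
  have A: "elts A = {y \<in> elts \<theta>. \<exists>f g. cls f \<in> elts \<theta> \<and> cls g \<in> elts \<theta> \<and> R (cls f) (cls g) \<and> y = pr f g}"
    by (simp add: A_def)
  have "A \<in> M" by (rule Pow_\<theta>) (auto simp: A)
  then obtain \<alpha> where \<alpha>: "A = cls \<alpha>" by (rule M_cases)
  have "R (cls f) (cls g) \<longleftrightarrow> eventually (\<lambda>x. p x (f x, g x) \<in> elts (\<alpha> x)) F"
    if fg: "cls f \<in> elts \<theta>" "cls g \<in> elts \<theta>" for f g
  proof -
    have "eventually (\<lambda>x. p x (f x, g x) \<in> elts (\<alpha> x)) F \<longleftrightarrow> pr f g \<in> elts A"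
      by (simp add: \<alpha> pr_def cls_mem_iff)
    also have "\<dots> \<longleftrightarrow> R (cls f) (cls g)"
    proof
      assume "pr f g \<in> elts A"
      then obtain f' g' where "cls f' \<in> elts \<theta>" "cls g' \<in> elts \<theta>" "R (cls f') (cls g')" "pr f g = pr f' g'"
        unfolding A by blast
      then show "R (cls f) (cls g)" using pr_inj [of f g f' g'] fg by simp
    qed (use fg pr_mem A in blast)
    finally show ?thesis by blast
  qed
  then show "\<exists>P. \<forall>f g. cls f \<in> elts \<theta> \<longrightarrow> cls g \<in> elts \<theta> \<longrightarrow>
      (R (cls f) (cls g) \<longleftrightarrow> eventually (\<lambda>x. P x (f x) (g x)) F)"
    by (intro exI [of _ "\<lambda>x y z. p x (y, z) \<in> elts (\<alpha> x)"]) simp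
qed

text \<open>Containment of all relations with \<open>\<theta>\<close>, rather than of all subsets of
  \<open>b\<close>, is the property that passes from \<open>b\<close> to families of at most
  \<open>\<theta>\<close> many subsets of \<open>b\<close>.\<close>

definition good :: "'v \<Rightarrow> bool" where
  "good b \<longleftrightarrow> b \<in> M \<and> all_internal (elts \<theta>) (elts b)"

lemma good_\<theta>: "good \<theta>"
  unfolding good_def using \<theta>_M all_internal_\<theta> by blast

lemma good_Un: "good a \<Longrightarrow> good b \<Longrightarrow> good (vset (elts a \<union> elts b))"
  unfolding good_def using Un_in_M all_internal_Un by blast

lemma good_Pow:
  assumes "good b" "elts A \<subseteq> elts b" shows "A \<in> M"
proof -
  obtain h where h: "b = cls h" using assms(1) unfolding good_def by (blast elim: M_cases)
  obtain P where P [rule_format]: "\<forall>f g. cls f \<in> elts \<theta> \<longrightarrow> cls g \<in> elts b \<longrightarrow>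
      (cls g \<in> elts A \<longleftrightarrow> eventually (\<lambda>x. P x (f x) (g x)) F)"
    using assms(1) [unfolded good_def, THEN conjunct2] by (rule all_internalE [where R = "\<lambda>_ y. y \<in> elts A"])
  \<comment> \<open>The relation coding \<open>A\<close> ignores its first argument, so it can be
    evaluated at any element of \<open>\<theta>\<close>; \<open>vnat 0\<close> represents
    itself.\<close>
  have 0: "cls (\<lambda>_. vnat 0) \<in> elts \<theta>" unfolding cls_vnat by (rule vnat_\<theta>)
  have "elts (cls (\<lambda>x. vset {y \<in> elts (h x). P x (vnat 0) y})) = {y \<in> elts (cls h). y \<in> elts A}"
  proof (rule cls_Collect)
    fix f assume "cls f \<in> elts (cls h)"
    then show "eventually (\<lambda>x. P x (vnat 0) (f x)) F \<longleftrightarrow> cls f \<in> elts A"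
      using P [OF 0, of f] h by simp
  qed
  also have "\<dots> = elts A" using assms(2) h by blast
  finally have "cls (\<lambda>x. vset {y \<in> elts (h x). P x (vnat 0) y}) = A" by (rule extensionality)
  then show ?thesis by (rule subst) (rule cls_in_M)
qed

text \<open>The family \<open>a\<close> is indexed by a subset \<open>T\<close> of \<open>\<theta>\<close>, and a relation on \<open>\<theta> \<times> b\<close>
  codes its members.\<close>

lemma good_family:
  assumes b: "good b" and ab: "\<And>B. B \<in> elts a \<Longrightarrow> elts B \<subseteq> elts b" and "elts a \<lesssim> elts \<theta>"
  shows "good a"
proof -
  obtain i where inj: "inj_on i (elts a)" and i\<theta>: "i ` elts a \<subseteq> elts \<theta>"
    using assms(3) unfolding lepoll_def by blast
  obtain \<beta> where \<beta>: "b = cls \<beta>" using b unfolding good_def by (blast elim: M_cases)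
  obtain P where P [rule_format]: "\<forall>f g. cls f \<in> elts \<theta> \<longrightarrow> cls g \<in> elts b \<longrightarrow>
      ((\<exists>B\<in>elts a. cls f = i B \<and> cls g \<in> elts B) \<longleftrightarrow> eventually (\<lambda>x. P x (f x) (g x)) F)"
    using b [unfolded good_def, THEN conjunct2] by (rule all_internalE [where R = "\<lambda>t y. \<exists>B\<in>elts a. t = i B \<and> y \<in> elts B"])
  define T where "T = vset (i ` elts a)"
  have T: "elts T = i ` elts a" by (simp add: T_def)
  have "T \<in> M" by (rule Pow_\<theta>) (use T i\<theta> in simp)
  then obtain \<tau> where \<tau>: "T = cls \<tau>" by (rule M_cases)
  \<comment> \<open>In the class, the row at the index \<open>i B\<close> is \<open>B\<close>, so
    the rows over \<open>T\<close> make up \<open>a\<close>.\<close>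
  define row where "row = (\<lambda>x t. vset {y \<in> elts (\<beta> x). P x t y})"
  have row: "cls (\<lambda>x. row x (f x)) = B" if B: "B \<in> elts a" "cls f = i B" for f B
  proof -
    have f: "cls f \<in> elts \<theta>" using that i\<theta> by auto
    have "elts (cls (\<lambda>x. vset {y \<in> elts (\<beta> x). P x (f x) y})) = {y \<in> elts (cls \<beta>). y \<in> elts B}"
    proof (rule cls_Collect)
      fix g assume "cls g \<in> elts (cls \<beta>)"
      then have "eventually (\<lambda>x. P x (f x) (g x)) F \<longleftrightarrow> (\<exists>B\<in>elts a. cls f = i B \<and> cls g \<in> elts B)"
        using P [OF f, of g] \<beta> by simp
      also have "\<dots> \<longleftrightarrow> cls g \<in> elts B" using B inj by (auto dest: inj_onD)
      finally show "eventually (\<lambda>x. P x (f x) (g x)) F \<longleftrightarrow> cls g \<in> elts B" .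
    qed
    also have "\<dots> = elts B" using ab [OF B(1)] \<beta> by blast
    finally show ?thesis unfolding row_def by (rule extensionality)
  qed
  have "elts (cls (\<lambda>x. vset (row x ` elts (\<tau> x)))) = elts a"
  proof (rule elts_cls_eqI)
    fix f
    show "eventually (\<lambda>x. f x \<in> elts (vset (row x ` elts (\<tau> x)))) F \<longleftrightarrow> cls f \<in> elts a"
    proof
      assume "eventually (\<lambda>x. f x \<in> elts (vset (row x ` elts (\<tau> x)))) F"
      then have "eventually (\<lambda>x. \<exists>t. t \<in> elts (\<tau> x) \<and> f x = row x t) F" by eventually_elim auto
      then obtain t where "eventually (\<lambda>x. t x \<in> elts (\<tau> x) \<and> f x = row x (t x)) F" by (rule ev_choice)
      then have t: "cls t \<in> elts T" "cls f = cls (\<lambda>x. row x (t x))"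
        by (simp_all add: \<tau> cls_mem_iff cls_eq_iff eventually_conj_iff)
      then obtain B where B: "B \<in> elts a" "cls t = i B" using T by auto
      then show "cls f \<in> elts a" using row t(2) by simp
    next
      assume f: "cls f \<in> elts a"
      have "i (cls f) \<in> elts (cls \<tau>)" using f T \<tau> by auto
      then obtain t where t: "i (cls f) = cls t" "eventually (\<lambda>x. t x \<in> elts (\<tau> x)) F" by (rule elts_cls_cases)
      have "cls f = cls (\<lambda>x. row x (t x))" using row [OF f] t(1) by simp
      then have "eventually (\<lambda>x. f x = row x (t x)) F" unfolding cls_eq_iff .
      then show "eventually (\<lambda>x. f x \<in> elts (vset (row x ` elts (\<tau> x)))) F"
        using t(2) by eventually_elim auto
    qed
  next
    show "elts a \<subseteq> M" using good_Pow [OF b] ab by blast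
  qed
  then have "cls (\<lambda>x. vset (row x ` elts (\<tau> x))) = a" by (rule extensionality)
  then have aM: "a \<in> M" by (rule subst) (rule cls_in_M)
  have "all_internal (elts \<theta>) (elts a)"
  proof (rule all_internalI)
    fix S :: "'v \<Rightarrow> 'v \<Rightarrow> bool"
    \<comment> \<open>Replacing the members of \<open>a\<close> by their indices turns
      \<open>S\<close> into a relation on \<open>\<theta> \<times> \<theta>\<close>, which is
      internal.\<close>
    obtain Q where Q [rule_format]: "\<forall>f g. cls f \<in> elts \<theta> \<longrightarrow> cls g \<in> elts \<theta> \<longrightarrow>
      ((\<exists>B\<in>elts a. S (cls f) B \<and> cls g = i B) \<longleftrightarrow> eventually (\<lambda>x. Q x (f x) (g x)) F)"
      using all_internal_\<theta> by (rule all_internalE [where R = "\<lambda>t u. \<exists>B\<in>elts a. S t B \<and> u = i B"])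
    have "S (cls f) (cls g) \<longleftrightarrow> eventually (\<lambda>x. \<exists>u. u \<in> elts (\<tau> x) \<and> Q x (f x) u \<and> g x = row x u) F"
      if f: "cls f \<in> elts \<theta>" and g: "cls g \<in> elts a" for f g
    proof
      assume S: "S (cls f) (cls g)"
      have "i (cls g) \<in> elts (cls \<tau>)" using g T \<tau> by auto
      then obtain u where u: "i (cls g) = cls u" "eventually (\<lambda>x. u x \<in> elts (\<tau> x)) F" by (rule elts_cls_cases)
      have "cls g = cls (\<lambda>x. row x (u x))" using row [OF g] u(1) by simp
      then have "eventually (\<lambda>x. g x = row x (u x)) F" unfolding cls_eq_iff .
      moreover have "cls u \<in> elts \<theta>" using u(1) g i\<theta> by auto
      then have "eventually (\<lambda>x. Q x (f x) (u x)) F" using Q [OF f, of u] S g u(1) by auto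
      ultimately show "eventually (\<lambda>x. \<exists>u. u \<in> elts (\<tau> x) \<and> Q x (f x) u \<and> g x = row x u) F"
        using u(2) by eventually_elim auto
    next
      assume "eventually (\<lambda>x. \<exists>u. u \<in> elts (\<tau> x) \<and> Q x (f x) u \<and> g x = row x u) F"
      then obtain u where "eventually (\<lambda>x. u x \<in> elts (\<tau> x) \<and> Q x (f x) (u x) \<and> g x = row x (u x)) F"
        by (rule ev_choice)
      then have u: "cls u \<in> elts T" "eventually (\<lambda>x. Q x (f x) (u x)) F" "cls g = cls (\<lambda>x. row x (u x))"
        by (simp_all add: \<tau> cls_mem_iff cls_eq_iff eventually_conj_iff)
      then have "cls u \<in> elts \<theta>" using T i\<theta> by auto
      then obtain B where B: "B \<in> elts a" "S (cls f) B" "cls u = i B" using Q [OF f, of u] u(2) by auto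
      then show "S (cls f) (cls g)" using row [OF B(1), of u] u(3) by simp
    qed
    then show "\<exists>P. \<forall>f g. cls f \<in> elts \<theta> \<longrightarrow> cls g \<in> elts a \<longrightarrow>
      (S (cls f) (cls g) \<longleftrightarrow> eventually (\<lambda>x. P x (f x) (g x)) F)"
      by (intro exI [of _ "\<lambda>x y z. \<exists>u. u \<in> elts (\<tau> x) \<and> Q x y u \<and> z = row x u"]) simp
  qed
  then show ?thesis using aM by (simp add: good_def)
qed

text \<open>\<open>R\<close> factors through \<open>\<theta>\<close> as the composition of the graph
  of an injection \<open>i\<close> of \<open>a\<close> and the relation between \<open>i y\<close>
  and \<open>z\<close> induced by \<open>R\<close>. Both factors are internal because
  \<open>a\<close> and \<open>b\<close> are good.\<close>

lemma good_all_internal: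
  assumes a: "good a" and b: "good b" and "elts a \<lesssim> elts \<theta>"
  shows "all_internal (elts a) (elts b)"
proof (rule all_internalI)
  fix R :: "'v \<Rightarrow> 'v \<Rightarrow> bool"
  obtain i where inj: "inj_on i (elts a)" and i\<theta>: "i ` elts a \<subseteq> elts \<theta>"
    using assms(3) unfolding lepoll_def by blast
  obtain t where t: "\<theta> = cls t" using \<theta>_M by (rule M_cases)
  obtain P where P [rule_format]: "\<forall>f g. cls f \<in> elts \<theta> \<longrightarrow> cls g \<in> elts a \<longrightarrow>
      (cls f = i (cls g) \<longleftrightarrow> eventually (\<lambda>x. P x (f x) (g x)) F)"
    using a [unfolded good_def, THEN conjunct2] by (rule all_internalE [where R = "\<lambda>t y. t = i y"])
  obtain Q where Q [rule_format]: "\<forall>f g. cls f \<in> elts \<theta> \<longrightarrow> cls g \<in> elts b \<longrightarrow>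
      ((\<exists>y\<in>elts a. cls f = i y \<and> R y (cls g)) \<longleftrightarrow> eventually (\<lambda>x. Q x (f x) (g x)) F)"
    using b [unfolded good_def, THEN conjunct2] by (rule all_internalE [where R = "\<lambda>t z. \<exists>y\<in>elts a. t = i y \<and> R y z"])
  have "R (cls f) (cls g) \<longleftrightarrow> eventually (\<lambda>x. \<exists>s. s \<in> elts (t x) \<and> P x s (f x) \<and> Q x s (g x)) F"
    if f: "cls f \<in> elts a" and g: "cls g \<in> elts b" for f g
  proof
    assume R: "R (cls f) (cls g)"
    have "i (cls f) \<in> elts (cls t)" using f i\<theta> t by auto
    then obtain s where s: "i (cls f) = cls s" "eventually (\<lambda>x. s x \<in> elts (t x)) F" by (rule elts_cls_cases)
    have s\<theta>: "cls s \<in> elts \<theta>" using s t by (simp add: cls_mem_iff)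
    have "eventually (\<lambda>x. P x (s x) (f x)) F" using P [OF s\<theta> f] s(1) by simp
    moreover have "eventually (\<lambda>x. Q x (s x) (g x)) F" using Q [OF s\<theta> g] s(1) f R by auto
    ultimately show "eventually (\<lambda>x. \<exists>s. s \<in> elts (t x) \<and> P x s (f x) \<and> Q x s (g x)) F"
      using s(2) by eventually_elim auto
  next
    assume "eventually (\<lambda>x. \<exists>s. s \<in> elts (t x) \<and> P x s (f x) \<and> Q x s (g x)) F"
    then obtain s where "eventually (\<lambda>x. s x \<in> elts (t x) \<and> P x (s x) (f x) \<and> Q x (s x) (g x)) F"
      by (rule ev_choice)
    then have s: "cls s \<in> elts \<theta>" "eventually (\<lambda>x. P x (s x) (f x)) F" "eventually (\<lambda>x. Q x (s x) (g x)) F"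
      by (simp_all add: t cls_mem_iff eventually_conj_iff)
    then obtain y where "y \<in> elts a" "cls s = i y" "R y (cls g)" using Q [OF s(1) g] by auto
    moreover have "cls s = i (cls f)" using P [OF s(1) f] s(2) by simp
    ultimately show "R (cls f) (cls g)" using inj f by (auto dest: inj_onD)
  qed
  then show "\<exists>P. \<forall>f g. cls f \<in> elts a \<longrightarrow> cls g \<in> elts b \<longrightarrow>
      (R (cls f) (cls g) \<longleftrightarrow> eventually (\<lambda>x. P x (f x) (g x)) F)"
    by (intro exI [of _ "\<lambda>x y z. \<exists>s. s \<in> elts (t x) \<and> P x s y \<and> Q x s z"]) simp
qed

end

section \<open>Cardinal arithmetic and the seed order\<close>

lemma inj_elts: "inj (elts :: 'v::zfc \<Rightarrow> 'v set)"
  by (rule injI) (rule extensionality)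

lemma Pow_lepoll_mono: "A \<lesssim> B \<Longrightarrow> Pow A \<lesssim> Pow B"
  unfolding lepoll_def by (metis image_Pow_mono inj_on_image_Pow)

lemma subsets_eqpoll_Pow: "small A \<Longrightarrow> {y. elts y \<subseteq> A} \<approx> Pow A"
proof -
  assume A: "small A"
  have "elts ` {y. elts y \<subseteq> A} = Pow A"
  proof
    show "Pow A \<subseteq> elts ` {y. elts y \<subseteq> A}"
    proof
      fix B assume "B \<in> Pow A"
      then have "elts (vset B) = B" by (intro elts_vset small_subset [OF A]) simp
      then show "B \<in> elts ` {y. elts y \<subseteq> A}" using \<open>B \<in> Pow A\<close> by (intro image_eqI [of _ _ "vset B"]) simp_all
    qed
  qed blast
  moreover have "inj_on elts {y :: 'a. elts y \<subseteq> A}" using inj_elts inj_on_subset by blast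
  ultimately show ?thesis by (metis bij_betw_def eqpoll_def)
qed

text \<open>A set of size \<open>Suc n\<close> arises by inserting a point into one of size
  \<open>n\<close>, and an infinite set absorbs its square.\<close>

lemma finite_subsets_lepoll:
  assumes S: "infinite S" shows "{A. A \<subseteq> S \<and> finite A \<and> card A = n} \<lesssim> S"
proof (induction n)
  case 0
  have "{A. A \<subseteq> S \<and> finite A \<and> card A = 0} = {{}}" by auto
  then show ?case using S finite_lepoll_infinite by (metis finite.emptyI finite.insertI)
next
  case (Suc n)
  let ?P = "\<lambda>n. {A. A \<subseteq> S \<and> finite A \<and> card A = n}"
  have "?P (Suc n) \<subseteq> (\<lambda>(a, A). insert a A) ` (S \<times> ?P n)"
  proof
    fix A assume A: "A \<in> ?P (Suc n)"
    then obtain a B where "A = insert a B" "a \<notin> B" "card B = n" "finite B"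
      by (auto simp: card_Suc_eq_finite)
    then show "A \<in> (\<lambda>(a, A). insert a A) ` (S \<times> ?P n)" using A by (auto intro!: image_eqI [of _ _ "(a, B)"])
  qed
  then have "?P (Suc n) \<lesssim> S \<times> ?P n" by (rule subset_image_lepoll)
  also have "\<dots> \<lesssim> S \<times> S" by (rule times_lepoll_mono [OF lepoll_refl Suc.IH])
  also have "\<dots> \<lesssim> S" using S by (rule infinite_Times_lepoll)
  finally show ?case .
qed

lemma elts_nsubsets [simp]:
  "elts (nsubsets \<kappa> n) = {a. elts a \<subseteq> elts \<kappa> \<and> finite (elts a) \<and> card (elts a) = n}"
  unfolding nsubsets_def by (rule elts_vset, rule small_subset [OF small_Pow]) auto

lemma nsubsets_lepoll:
  assumes "infinite (elts \<kappa>)" shows "elts (nsubsets (\<kappa>::'v::zfc) n) \<lesssim> elts \<kappa>"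
proof -
  have "elts (nsubsets \<kappa> n) \<lesssim> elts ` elts (nsubsets \<kappa> n)"
    using inj_elts by (meson eqpoll_imp_lepoll eqpoll_sym inj_on_image_eqpoll_self inj_on_subset subset_UNIV)
  also have "\<dots> \<lesssim> {A. A \<subseteq> elts \<kappa> \<and> finite A \<and> card A = n}" by (rule subset_imp_lepoll) auto
  also have "\<dots> \<lesssim> elts \<kappa>" using assms by (rule finite_subsets_lepoll)
  finally show ?thesis .
qed

lemma UN_lepoll:
  assumes "infinite B" "I \<lesssim> B" "\<And>i. i \<in> I \<Longrightarrow> A i \<lesssim> B" shows "(\<Union>i\<in>I. A i) \<lesssim> B"
  using card_of_UNION_ordLeq_infinite [of B I A] assms unfolding lepoll_def card_of_ordLeq by blast

section \<open>Uniform ultrafilters and the order on finite sets of ordinals\<close>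

lemma uniform_base: "uniform_on U \<kappa> n \<Longrightarrow> base U = nsubsets \<kappa> n"
  unfolding uniform_on_def using base_eq by blast

text \<open>Any element of the common underlying set determines \<open>n\<close> as its size; then
  minimality of either ordinal excludes that it lies above the other.\<close>

lemma uniform_on_unique:
  assumes "uniform_on U \<kappa> n" "uniform_on U \<kappa>' n'" shows "\<kappa> = \<kappa>'"
proof -
  have eq: "nsubsets \<kappa> n = nsubsets \<kappa>' n'" using assms uniform_base by metis
  have u: "nsubsets \<kappa> n \<in> elts U" "vset {} \<notin> elts U"
    using assms(1) unfolding uniform_on_def cc_ultrafilter_on_def ultrafilter_on_def by blast+
  then have "nsubsets \<kappa> n \<noteq> vset {}" by metis
  then have "elts (nsubsets \<kappa> n) \<noteq> {}" by (metis vset_elts)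
  then obtain a where "a \<in> elts (nsubsets \<kappa> n)" by blast
  moreover from this have "a \<in> elts (nsubsets \<kappa>' n')" using eq by simp
  ultimately have "n = n'" by simp
  then have "\<kappa> \<notin> elts \<kappa>'" "\<kappa>' \<notin> elts \<kappa>" using assms u eq unfolding uniform_on_def by auto
  then show ?thesis using assms Ord_linear unfolding uniform_on_def by blast
qed

lemma sp_eq: "uniform_on U \<kappa> n \<Longrightarrow> sp U = \<kappa>"
  unfolding sp_def using uniform_on_unique by (blast intro!: the_equality)

lemma Ord_finite_max:
  assumes "finite S" "S \<noteq> {}" "\<And>z. z \<in> S \<Longrightarrow> Ord (z::'v::zfc)"
  shows "\<exists>m\<in>S. \<forall>z\<in>S. z = m \<or> z \<in> elts m"
  using assms
proof (induction rule: finite_ne_induct)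
  case (insert x S)
  then obtain m where m: "m \<in> S" "\<forall>z\<in>S. z = m \<or> z \<in> elts m" by auto
  have ord: "Ord x" "Ord m" using insert.prems m(1) by auto
  then consider "m \<in> elts x" | "x = m \<or> x \<in> elts m" using Ord_linear by blast
  then show ?case
  proof cases
    case 1
    then have "z \<in> elts x" if "z \<in> S" for z using m(2) that 1 Ord_trans [OF ord(1) 1] by auto
    then show ?thesis by blast
  qed (use m in blast)
qed simp

text \<open>If some element of \<open>b\<close> exceeded all of \<open>x\<close>, so would the
  maximum of \<open>b\<close>, which would then be the largest element of the symmetric
  difference.\<close>

lemma not_fs_less_bounded:
  assumes x: "finite (elts x)" "\<And>\<xi>. \<xi> \<in> elts x \<Longrightarrow> Ord \<xi>"
    and b: "finite (elts b)" "\<And>\<beta>. \<beta> \<in> elts b \<Longrightarrow> Ord \<beta>"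
    and less: "\<not> fs_less x b" and \<beta>: "\<beta> \<in> elts b"
  shows "\<exists>\<xi>\<in>elts x. \<beta> = \<xi> \<or> \<beta> \<in> elts \<xi>"
proof (rule ccontr)
  assume *: "\<not> ?thesis"
  obtain m where m: "m \<in> elts b" "\<forall>z\<in>elts b. z = m \<or> z \<in> elts m"
    using Ord_finite_max [OF b(1) _ b(2)] \<beta> by blast
  have xm: "\<xi> \<in> elts m" if "\<xi> \<in> elts x" for \<xi>
  proof -
    have \<xi>: "\<xi> \<in> elts \<beta>" using * that Ord_linear [OF x(2) [OF that] b(2) [OF \<beta>]] by blast
    have "\<beta> = m \<or> \<beta> \<in> elts m" using m(2) \<beta> by blast
    then show ?thesis using \<xi> Ord_trans [OF b(2) [OF m(1)] _ \<xi>] by auto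
  qed
  then have "m \<notin> elts x" using mem_irrefl by blast
  then have "fs_less x b" unfolding fs_less_def Let_def
    using m xm by (intro bexI [of _ m]) auto
  then show False using less by blast
qed

text \<open>The deciding element of the symmetric difference is chosen pointwise, and its class
  decides the comparison in the ultrapower.\<close>

lemma (in cc_ultra) fs_less_cls:
  assumes "eventually (\<lambda>x. fs_less (a x) (b x)) F" shows "fs_less (cls a) (cls b)"
proof -
  have "eventually (\<lambda>x. \<exists>m. m \<in> elts (b x) \<and> m \<notin> elts (a x) \<and>
     (\<forall>z. (z \<in> elts (a x) - elts (b x) \<or> z \<in> elts (b x) - elts (a x)) \<longrightarrow> z = m \<or> z \<in> elts m)) F"
    using assms by eventually_elim (auto simp: fs_less_def Let_def)
  then obtain m where m: "eventually (\<lambda>x. m x \<in> elts (b x) \<and> m x \<notin> elts (a x) \<and>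
     (\<forall>z. (z \<in> elts (a x) - elts (b x) \<or> z \<in> elts (b x) - elts (a x)) \<longrightarrow> z = m x \<or> z \<in> elts (m x))) F"
    by (rule ev_choice)
  have "cls m \<in> elts (cls b)" "cls m \<notin> elts (cls a)"
    using m by (simp_all add: cls_mem_iff eventually_conj_iff)
  moreover have "z = cls m \<or> z \<in> elts (cls m)"
    if z: "z \<in> elts (cls a) - elts (cls b) \<or> z \<in> elts (cls b) - elts (cls a)" for z
  proof -
    obtain f where f: "z = cls f" using z by (blast elim: elts_cls_cases)
    have "eventually (\<lambda>x. (f x \<in> elts (a x) \<and> f x \<notin> elts (b x)) \<or> (f x \<in> elts (b x) \<and> f x \<notin> elts (a x))) F"
      using z unfolding f by (auto simp: ev_disj eventually_conj_iff cls_mem_iff)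
    then have "eventually (\<lambda>x. f x = m x \<or> f x \<in> elts (m x)) F"
      using m by eventually_elim blast
    then show ?thesis by (simp add: f ev_disj cls_mem_iff cls_eq_iff)
  qed
  ultimately show ?thesis unfolding fs_less_def Let_def by (intro bexI [of _ "cls m"]) auto
qed

lemma (in cc_ultra) infinite_base:
  assumes "nonprincipal U" shows "infinite (elts X)"
proof
  assume fin: "finite (elts X)"
  have "eventually (\<lambda>y. \<forall>x\<in>elts X. y \<noteq> x) F"
  proof (rule eventually_ball_finite [OF fin], rule ballI)
    fix x assume x: "x \<in> elts X"
    then have "\<not> eventually (\<lambda>y. y = x) F"
      using assms mem_U_iff [of "vset {x}"] unfolding nonprincipal_def by simp
    then show "eventually (\<lambda>y. y \<noteq> x) F" by simp
  qed
  then show False by (rule ev_witness) blast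
qed

section \<open>Counting families below an ordinal\<close>

lemma card_Pow_in_two_pow_less:
  assumes "\<alpha> \<in> elts \<kappa>" shows "{y. elts y \<subseteq> elts \<alpha>} \<lesssim> elts (two_pow_less (\<kappa>::'v::zfc))"
proof -
  have "{y. elts y \<subseteq> elts \<alpha>} \<approx> elts (vcard (vpow \<alpha>))"
    using vcard_eqpoll [of "vpow \<alpha>"] eqpoll_sym by simp
  moreover have "elts (vcard (vpow \<alpha>)) \<subseteq> elts (two_pow_less \<kappa>)"
    using assms by (auto simp: two_pow_less_def)
  ultimately show ?thesis by (meson eqpoll_imp_lepoll lepoll_trans subset_imp_lepoll)
qed

text \<open>By Cantor's theorem \<open>\<alpha>\<close> is below the cardinal of its power
  set.\<close>

lemma subset_two_pow_less:
  assumes "Ord \<kappa>" shows "elts \<kappa> \<subseteq> elts (two_pow_less (\<kappa>::'v::zfc))"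
proof
  fix \<alpha> assume \<alpha>: "\<alpha> \<in> elts \<kappa>"
  have "\<alpha> \<in> elts (vcard (vpow \<alpha>))"
  proof (rule ccontr)
    assume "\<alpha> \<notin> elts (vcard (vpow \<alpha>))"
    then have "elts (vcard (vpow \<alpha>)) \<subseteq> elts \<alpha>"
      using Ord_mem_or_subset Ord_in_Ord [OF assms \<alpha>] Ord_vcard by blast
    then have "elts (vpow \<alpha>) \<lesssim> elts \<alpha>"
      using vcard_eqpoll [of "vpow \<alpha>"] by (meson eqpoll_imp_lepoll eqpoll_sym lepoll_trans subset_imp_lepoll)
    moreover have "elts (vpow \<alpha>) \<approx> Pow (elts \<alpha>)" using subsets_eqpoll_Pow [OF small_elts] by simp
    ultimately have "Pow (elts \<alpha>) \<lesssim> elts \<alpha>" by (meson eqpoll_imp_lepoll eqpoll_sym lepoll_trans)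
    then show False using lesspoll_Pow_self [of "elts \<alpha>"] lepoll_antisym lesspoll_def by blast
  qed
  then show "\<alpha> \<in> elts (two_pow_less \<kappa>)" using \<alpha> by (auto simp: two_pow_less_def)
qed

text \<open>The members of \<open>D\<close> are finite subsets of \<open>\<mu> + 1\<close> where \<open>\<mu> < \<kappa>\<close> is the maximum of \<open>x\<close>, so
  for infinite \<open>\<mu>\<close> there are at most as many families of them as subsets of \<open>\<mu>\<close>.\<close>

lemma families_below_lepoll:
  assumes \<kappa>: "Ord \<kappa>" "infinite (elts \<kappa>)" and x: "x \<in> elts (nsubsets \<kappa> n)"
    and D: "\<And>b. b \<in> elts D \<Longrightarrow> finite (elts b) \<and> card (elts b) = k \<and> (\<forall>\<beta>\<in>elts b. \<exists>\<xi>\<in>elts x. \<beta> = \<xi> \<or> \<beta> \<in> elts \<xi>)"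
  shows "{B. elts B \<subseteq> elts D} \<lesssim> elts (two_pow_less (\<kappa>::'v::zfc))"
proof (cases "finite (elts D)")
  case True
  have "infinite (elts (two_pow_less \<kappa>))" using subset_two_pow_less [OF \<kappa>(1)] \<kappa>(2) finite_subset by blast
  moreover have "finite {B. elts B \<subseteq> elts D}"
    using True subsets_eqpoll_Pow [OF small_elts] by (metis eqpoll_finite_iff finite_Pow_iff)
  ultimately show ?thesis by (metis finite_lepoll_infinite)
next
  case False
  have ord: "Ord \<xi>" if "\<xi> \<in> elts x" for \<xi> using x that Ord_in_Ord [OF \<kappa>(1)] by auto
  \<comment> \<open>For empty \<open>x\<close> the only possible member of \<open>D\<close> is the
    empty set, so \<open>D\<close> would be finite.\<close>
  have "elts x \<noteq> {}"
  proof
    assume "elts x = {}"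
    then have "elts D \<subseteq> {vset {}}" using D by (metis all_not_in_conv insertI1 subsetI vset_elts)
    then show False using False finite_subset by blast
  qed
  then obtain \<mu> where \<mu>: "\<mu> \<in> elts x" "\<forall>z\<in>elts x. z = \<mu> \<or> z \<in> elts \<mu>"
    using Ord_finite_max [of "elts x"] ord x by auto
  have sub: "elts b \<subseteq> insert \<mu> (elts \<mu>)" if "b \<in> elts D" for b
    
  proof
    fix \<beta> assume "\<beta> \<in> elts b"
    then obtain \<xi> where \<xi>: "\<xi> \<in> elts x" "\<beta> = \<xi> \<or> \<beta> \<in> elts \<xi>" using D [OF \<open>b \<in> elts D\<close>] by blast
    have "\<xi> = \<mu> \<or> \<xi> \<in> elts \<mu>" using \<mu>(2) \<xi>(1) by blast
    then show "\<beta> \<in> insert \<mu> (elts \<mu>)" using \<xi>(2) Ord_trans [OF ord [OF \<mu>(1)], of \<xi> \<beta>] by auto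
  qed
  define \<mu>' where "\<mu>' = vset (insert \<mu> (elts \<mu>))"
  have \<mu>': "elts \<mu>' = insert \<mu> (elts \<mu>)" by (simp add: \<mu>'_def)
  have D\<mu>: "elts D \<subseteq> elts (nsubsets \<mu>' k)" using sub D \<mu>' by auto
  have "infinite (elts \<mu>)"
  proof
    assume "finite (elts \<mu>)"
    then have "finite {y. elts y \<subseteq> elts \<mu>'}"
      using subsets_eqpoll_Pow [OF small_elts, of \<mu>'] by (metis \<mu>' eqpoll_finite_iff finite_Pow_iff finite_insert)
    moreover have "elts D \<subseteq> {y. elts y \<subseteq> elts \<mu>'}" using D\<mu> by auto
    ultimately show False using False finite_subset by blast
  qed
  then have "elts D \<lesssim> elts \<mu>"
  proof -
    have "elts D \<lesssim> elts (nsubsets \<mu>' k)" using D\<mu> by (rule subset_imp_lepoll)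
    also have "\<dots> \<lesssim> elts \<mu>'" using \<open>infinite (elts \<mu>)\<close> \<mu>' by (intro nsubsets_lepoll) simp
    also have "\<dots> \<lesssim> elts \<mu>" unfolding \<mu>' using \<open>infinite (elts \<mu>)\<close> by (rule infinite_insert_lepoll)
    finally show ?thesis .
  qed
  then have "Pow (elts D) \<lesssim> Pow (elts \<mu>)" by (rule Pow_lepoll_mono)
  then have "{B. elts B \<subseteq> elts D} \<lesssim> {y. elts y \<subseteq> elts \<mu>}"
    using subsets_eqpoll_Pow [OF small_elts, of D] subsets_eqpoll_Pow [OF small_elts, of \<mu>]
    by (meson eqpoll_imp_lepoll eqpoll_sym lepoll_trans)
  also have "\<dots> \<lesssim> elts (two_pow_less \<kappa>)" by (rule card_Pow_in_two_pow_less) (use x \<mu> in auto)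
  finally show ?thesis .
qed

section \<open>Limits of ultrafilters\<close>

text \<open>Membership in \<open>U1\<close> is decided by the seed \<open>a1\<close>, viewed in the
  common ultrapower as an element of the ultraproduct over \<open>U0\<close>. The failed inequality
  of the seeds lets each fibre discard the part of \<open>A\<close> above \<open>x\<close>.\<close>

lemma comparison_limit:
  fixes U0 U1 :: "'v::zfc"
  assumes U0: "cc_ultrafilter UNIV U0" and U1: "cc_ultrafilter UNIV U1" and comp: "comparison U0 U1 W0 W1"
    and less: "\<not> fs_less (ult_emb (Ult UNIV U0) W0 (ult_id UNIV U0)) (ult_emb (Ult UNIV U1) W1 (ult_id UNIV U1))"
  obtains \<Phi> where "\<forall>A. elts A \<subseteq> elts (base U1) \<longrightarrow>
      (A \<in> elts U1 \<longleftrightarrow> eventually (\<lambda>x. \<Phi> x (vset {b \<in> elts A. \<not> fs_less x b})) (ult_filter U0))"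
proof -
  interpret A: cc_ultra U0 by unfold_locales (rule U0)
  interpret B: cc_ultra U1 by unfold_locales (rule U1)
  have W: "cc_ultrafilter A.M W0" "cc_ultrafilter B.M W1" and Ult_eq: "Ult A.M W0 = Ult B.M W1"
    and emb: "\<And>x. ult_emb A.M W0 (ult_emb UNIV U0 x) = ult_emb B.M W1 (ult_emb UNIV U1 x)"
    using comp unfolding comparison_def by (auto dest: fun_cong simp: fun_eq_iff)
  have "W0 \<in> A.M" "W1 \<in> B.M"
    using W unfolding cc_ultrafilter_def cc_ultrafilter_on_def ultrafilter_on_def by blast+
  then obtain w0 w1 where w: "W0 = A.cls w0" "W1 = B.cls w1" by (metis A.M_cases B.M_cases)
  interpret A: internal_ultra U0 w0 by unfold_locales (use W w in simp)
  interpret B: internal_ultra U1 w1 by unfold_locales (use W w in simp)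
  define a1 where "a1 = ult_emb B.M W1 (ult_id UNIV U1)"
  have "a1 = B.cls (\<lambda>x. ucl (w1 x) (\<lambda>_. x))"
    unfolding a1_def w B.id_eq B.ult_emb_W by (simp add: ult_emb_def ucl_def)
  \<comment> \<open>The equality of the two iterated ultrapowers transfers \<open>a1\<close> to the
    side of \<open>U0\<close>, where the functions \<open>g x\<close> represent it.\<close>
  then have "a1 \<in> Ult B.M W1" unfolding w B.Ult_W_iff by (intro exI [of _ "\<lambda>x _. x"])
  then have "a1 \<in> Ult A.M W0" by (simp only: Ult_eq)
  then obtain g where a1: "a1 = A.cls (\<lambda>x. ucl (w0 x) (g x))" unfolding w A.Ult_W_iff by blast
  define \<Phi> where "\<Phi> = (\<lambda>x A. ucl (w0 x) (g x) \<in> elts (ult_emb UNIV (w0 x) A))"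
  have "A.cls (\<lambda>x. ult_emb UNIV (w0 x) x) = ult_emb A.M W0 (ult_id UNIV U0)"
    unfolding w A.id_eq A.ult_emb_W ..
  then have "\<not> fs_less (A.cls (\<lambda>x. ult_emb UNIV (w0 x) x)) (A.cls (\<lambda>x. ucl (w0 x) (g x)))"
    using less a1 unfolding a1_def by simp
  then have bounded: "eventually (\<lambda>x. \<not> fs_less (ult_emb UNIV (w0 x) x) (ucl (w0 x) (g x))) A.F"
    using A.fs_less_cls by auto
  \<comment> \<open>Thus \<open>\<Phi> x\<close> depends only on the members of \<open>A\<close>
    that are not above \<open>x\<close>.\<close>
  have cut: "eventually (\<lambda>x. \<Phi> x A \<longleftrightarrow> \<Phi> x (vset {b \<in> elts A. \<not> fs_less x b})) A.F" for A
    using bounded A.ev_cc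
  proof eventually_elim
    case (elim x)
    interpret C: cc_ultra "w0 x" by (rule elim(2))
    \<comment> \<open>\<open>fs_less_cls\<close> is used in contrapositive form, now for the
      ultrapower by \<open>w0 x\<close>; the ultrafilter then turns the failure into one at almost
      all \<open>y\<close>.\<close>
    have "\<not> eventually (\<lambda>y. fs_less x (g x y)) C.F"
      using elim(1) C.fs_less_cls [of "\<lambda>_. x" "g x"] unfolding C.emb_eq by blast
    then have "eventually (\<lambda>y. \<not> fs_less x (g x y)) C.F" by simp
    then have "eventually (\<lambda>y. g x y \<in> elts A \<longleftrightarrow> g x y \<in> elts (vset {b \<in> elts A. \<not> fs_less x b})) C.F"
      by eventually_elim simp
    then show ?case unfolding \<Phi>_def C.emb_eq C.cls_mem_iff C.ev_iff .
  qed
  have "A \<in> elts U1 \<longleftrightarrow> eventually (\<lambda>x. \<Phi> x (vset {b \<in> elts A. \<not> fs_less x b})) A.F"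
    if A: "elts A \<subseteq> elts (base U1)" for A
  proof -
    have "A \<in> elts U1 \<longleftrightarrow> ult_id UNIV U1 \<in> elts (ult_emb UNIV U1 A)"
      using A unfolding B.mem_U_iff B.id_eq B.emb_eq B.cls_mem_iff by blast
    also have "\<dots> \<longleftrightarrow> a1 \<in> elts (ult_emb B.M W1 (ult_emb UNIV U1 A))"
      unfolding a1_def w by (rule B.ult_emb_W_mem_iff [symmetric]) (simp_all add: B.id_eq B.emb_eq)
    \<comment> \<open>Here the commutativity of the comparison replaces the embeddings on the side
      of \<open>U1\<close> by those on the side of \<open>U0\<close>.\<close>
    also have "\<dots> \<longleftrightarrow> a1 \<in> elts (ult_emb A.M W0 (ult_emb UNIV U0 A))" by (simp add: emb)
    also have "\<dots> \<longleftrightarrow> eventually (\<lambda>x. \<Phi> x A) A.F"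
      unfolding w A.emb_eq A.ult_emb_W a1 A.cls_mem_iff \<Phi>_def ..
    also have "\<dots> \<longleftrightarrow> eventually (\<lambda>x. \<Phi> x (vset {b \<in> elts A. \<not> fs_less x b})) A.F"
      using cut [of A] unfolding A.ev_iff .
    finally show ?thesis .
  qed
  then show ?thesis by (intro that [of \<Phi>]) blast
qed

text \<open>Everything on the right side of \<open>lim\<close> has a copy in
  \<open>Ult UNIV U1\<close>: \<open>U0\<close> by assumption, \<open>\<Phi>\<close> and the order
  on the relevant sets by \<open>good_all_internal\<close>. So \<open>U1\<close> is definable there,
  against irreflexivity.\<close>

lemma bounded_limit_false:
  fixes U0 U1 :: "'v::zfc"
  assumes U0: "uniform_on U0 \<kappa>0 n0" and U1: "uniform_on U1 \<kappa>1 n1" and np: "nonprincipal U1"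
    and U0M: "U0 \<in> Ult UNIV U1"
    and Pow: "elts (vpow (two_pow_less \<kappa>0)) \<subseteq> Ult UNIV U1"
    and lim: "\<And>A. elts A \<subseteq> elts (base U1) \<Longrightarrow>
      A \<in> elts U1 \<longleftrightarrow> eventually (\<lambda>x. \<Phi> x (vset {b \<in> elts A. \<not> fs_less x b})) (ult_filter U0)"
  shows False
proof -
  have cc: "cc_ultrafilter UNIV U0" "cc_ultrafilter UNIV U1" and ord: "Ord \<kappa>0" "Ord \<kappa>1"
    using U0 U1 unfolding uniform_on_def cc_ultrafilter_def by blast+
  interpret A: cc_ultra U0 by unfold_locales (rule cc)
  interpret B: cc_ultra U1 by unfold_locales (rule cc)
  define X0 where "X0 = nsubsets \<kappa>0 n0"
  define X1 where "X1 = nsubsets \<kappa>1 n1"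
  have X: "base U0 = X0" "base U1 = X1" using U0 U1 uniform_base by (auto simp: X0_def X1_def)
  have X0E: "elts x \<subseteq> elts \<kappa>0" "finite (elts x)" "card (elts x) = n0" if "x \<in> elts X0" for x
    using that by (auto simp: X0_def)
  have X1E: "elts b \<subseteq> elts \<kappa>1" "finite (elts b)" "card (elts b) = n1" if "b \<in> elts X1" for b
    using that by (auto simp: X1_def)
  define D where "D = (\<lambda>x. vset {b \<in> elts X1. \<not> fs_less x b})"
  have D: "elts (D x) = {b \<in> elts X1. \<not> fs_less x b}" for x by (simp add: D_def)
  have below: "\<forall>\<beta>\<in>elts b. \<exists>\<xi>\<in>elts x. \<beta> = \<xi> \<or> \<beta> \<in> elts \<xi>" if x: "x \<in> elts X0" and b: "b \<in> elts (D x)" for x b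
  proof
    fix \<beta> assume \<beta>: "\<beta> \<in> elts b"
    have b1: "b \<in> elts X1" and less: "\<not> fs_less x b" using b D by auto
    show "\<exists>\<xi>\<in>elts x. \<beta> = \<xi> \<or> \<beta> \<in> elts \<xi>"
    proof (rule not_fs_less_bounded [OF X0E(2) [OF x] _ X1E(2) [OF b1] _ less \<beta>])
      show "Ord \<xi>" if "\<xi> \<in> elts x" for \<xi> using X0E(1) [OF x] that Ord_in_Ord [OF ord(1)] by blast
      show "Ord \<beta>" if "\<beta> \<in> elts b" for \<beta> using X1E(1) [OF b1] that Ord_in_Ord [OF ord(2)] by blast
    qed
  qed
  have D\<kappa>: "elts b \<subseteq> elts \<kappa>0" if x: "x \<in> elts X0" and b: "b \<in> elts (D x)" for x b
  proof
    fix \<beta> assume "\<beta> \<in> elts b"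
    then obtain \<xi> where \<xi>: "\<xi> \<in> elts x" "\<beta> = \<xi> \<or> \<beta> \<in> elts \<xi>" using below [OF x b] by blast
    then have "\<xi> \<in> elts \<kappa>0" using X0E(1) [OF x] by blast
    then show "\<beta> \<in> elts \<kappa>0" using \<xi>(2) Ord_trans [OF ord(1)] by blast
  qed
  have X1_U1: "X1 \<in> elts U1" using B.mem_U_iff B.ev_base X by simp
  \<comment> \<open>At each \<open>x\<close> in \<open>X0\<close> the cut of \<open>X1\<close>
    consists of subsets of \<open>\<kappa>0\<close>, so \<open>X1\<close> and its part below
    \<open>\<kappa>0\<close> have the same cuts. By \<open>lim\<close> that part is in
    \<open>U1\<close>, and \<open>\<kappa>0 \<in> elts \<kappa>1\<close> would contradict the
    minimality of \<open>\<kappa>1\<close>.\<close>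
  have \<kappa>: "elts \<kappa>1 \<subseteq> elts \<kappa>0"
  proof (rule ccontr)
    assume "\<not> elts \<kappa>1 \<subseteq> elts \<kappa>0"
    then have \<kappa>01: "\<kappa>0 \<in> elts \<kappa>1" using Ord_mem_or_subset ord by blast
    define A where "A = vset {b \<in> elts X1. elts b \<subseteq> elts \<kappa>0}"
    have A: "elts A = {b \<in> elts X1. elts b \<subseteq> elts \<kappa>0}" by (simp add: A_def)
    have "eventually (\<lambda>x. \<Phi> x (vset {b \<in> elts X1. \<not> fs_less x b})) A.F" using X1_U1 lim [of X1] X by simp
    then have "eventually (\<lambda>x. \<Phi> x (vset {b \<in> elts A. \<not> fs_less x b})) A.F"
      using A.ev_base
    proof eventually_elim
      case (elim x)
      have "{b \<in> elts A. \<not> fs_less x b} = {b \<in> elts X1. \<not> fs_less x b}"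
        using D\<kappa> [of x] elim(2) X A D by auto
      then show ?case using elim(1) by simp
    qed
    then have "A \<in> elts U1" using lim [of A] A X by auto
    moreover have "elts A \<subseteq> elts (nsubsets \<kappa>0 n1)" using A X1E by auto
    moreover have "elts \<kappa>0 \<subseteq> elts \<kappa>1" using \<kappa>01 ord(2) Ord_trans by blast
    then have "elts (nsubsets \<kappa>0 n1) \<subseteq> elts (base U1)" unfolding X X1_def by auto
    ultimately have "nsubsets \<kappa>0 n1 \<in> elts U1"
      unfolding B.mem_U_iff
      using eventually_mono [of "\<lambda>b. b \<in> elts A" B.F "\<lambda>b. b \<in> elts (nsubsets \<kappa>0 n1)"] by blast
    then show False using U1 \<kappa>01 unfolding uniform_on_def by blast
  qed
  have inf: "infinite (elts \<kappa>0)"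
  proof
    assume "finite (elts \<kappa>0)"
    then have "finite (Pow (elts \<kappa>1))" using \<kappa> finite_subset by auto
    moreover have "elts ` elts X1 \<subseteq> Pow (elts \<kappa>1)" using X1E by blast
    ultimately have "finite (elts ` elts X1)" using finite_subset by blast
    then have "finite (elts X1)" using inj_elts by (meson finite_imageD inj_on_subset subset_UNIV)
    then show False using B.infinite_base [OF np] X by simp
  qed
  define \<theta> where "\<theta> = two_pow_less \<kappa>0"
  have \<kappa>\<theta>: "elts \<kappa>0 \<subseteq> elts \<theta>" unfolding \<theta>_def using ord(1) by (rule subset_two_pow_less)
  interpret B: many_subsets U1 \<theta>
  proof
    show "vnat n \<in> elts \<theta>" for n using vnat_in_infinite_Ord [OF ord(1) inf] \<kappa>\<theta> by blast
    show "A \<in> Ult UNIV U1" if "elts A \<subseteq> elts \<theta>" for A using Pow that unfolding \<theta>_def by auto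
  qed
  have \<kappa>0\<theta>: "elts \<kappa>0 \<lesssim> elts \<theta>" using \<kappa>\<theta> by (rule subset_imp_lepoll)
  have X0\<theta>: "elts X0 \<lesssim> elts \<theta>" unfolding X0_def using nsubsets_lepoll [OF inf] \<kappa>0\<theta> by (rule lepoll_trans)
  have "elts X1 \<subseteq> elts (nsubsets \<kappa>0 n1)" using \<kappa> by (auto simp: X1_def)
  then have X1\<theta>: "elts X1 \<lesssim> elts \<theta>" using nsubsets_lepoll [OF inf] \<kappa>0\<theta> by (meson lepoll_trans subset_imp_lepoll)
  have good_X0: "B.good X0" by (rule B.good_family [OF B.good_\<theta> _ X0\<theta>]) (use X0E \<kappa>\<theta> in blast)
  have good_X1: "B.good X1" by (rule B.good_family [OF B.good_\<theta> _ X1\<theta>]) (use X1E \<kappa> \<kappa>\<theta> in blast)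
  have good_\<kappa>1: "B.good \<kappa>1"
  proof (rule B.good_family [OF B.good_\<theta>])
    show "elts B \<subseteq> elts \<theta>" if "B \<in> elts \<kappa>1" for B using that \<kappa> \<kappa>\<theta> Ord_trans [OF ord(2) that] by blast
    show "elts \<kappa>1 \<lesssim> elts \<theta>" using \<kappa> \<kappa>\<theta> by (intro subset_imp_lepoll) blast
  qed
  \<comment> \<open>\<open>E\<close> collects all second arguments at which \<open>\<Phi>\<close>
    has to be known: the cut at \<open>x\<close> of any subset of \<open>X1\<close> is a subset of
    \<open>D x\<close>. It is a union of at most \<open>\<theta>\<close> many sets of size at most
    \<open>\<theta>\<close>.\<close>
  define E where "E = vset (\<Union>x\<in>elts X0. {B. elts B \<subseteq> elts (D x)})"
  have E: "elts E = (\<Union>x\<in>elts X0. {B. elts B \<subseteq> elts (D x)})"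
    unfolding E_def by (intro elts_vset small_UN small_elts small_Pow)
  have "elts E \<lesssim> elts \<theta>"
    unfolding E
  proof (rule UN_lepoll [OF B.infinite_\<theta> X0\<theta>])
    fix x assume x: "x \<in> elts X0"
    show "{B. elts B \<subseteq> elts (D x)} \<lesssim> elts \<theta>"
      unfolding \<theta>_def
    proof (rule families_below_lepoll [OF ord(1) inf])
      show "x \<in> elts (nsubsets \<kappa>0 n0)" using x by (simp add: X0_def)
      show "finite (elts b) \<and> card (elts b) = n1 \<and> (\<forall>\<beta>\<in>elts b. \<exists>\<xi>\<in>elts x. \<beta> = \<xi> \<or> \<beta> \<in> elts \<xi>)"
        if "b \<in> elts (D x)" for b
        using below [OF x that] X1E [of b] that D by simp
    qed
  qed
  \<comment> \<open>The second round of \<open>good_family\<close>: members of \<open>E\<close> are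
    families of elements of \<open>X1\<close>, which the first round made good.\<close>
  then have good_E: "B.good E" by (rule B.good_family [OF good_X1, rotated]) (use E D in blast)
  obtain P where P [rule_format]: "\<forall>f g. B.cls f \<in> elts X0 \<longrightarrow> B.cls g \<in> elts E \<longrightarrow>
      (\<Phi> (B.cls f) (B.cls g) \<longleftrightarrow> eventually (\<lambda>z. P z (f z) (g z)) B.F)"
    using B.good_all_internal [OF good_X0 good_E X0\<theta>] by (rule B.all_internalE [where R = \<Phi>])
  obtain Q where Q [rule_format]: "\<forall>f g. B.cls f \<in> elts X0 \<longrightarrow> B.cls g \<in> elts X1 \<longrightarrow>
      (\<not> fs_less (B.cls f) (B.cls g) \<longleftrightarrow> eventually (\<lambda>z. Q z (f z) (g z)) B.F)"
    using B.good_all_internal [OF good_X0 good_X1 X0\<theta>]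
    by (rule B.all_internalE [where R = "\<lambda>x b. \<not> fs_less x b"])
  obtain u where u: "U0 = B.cls u" using U0M by (rule B.M_cases)
  obtain \<xi>0 where \<xi>0: "X0 = B.cls \<xi>0" using good_X0 unfolding B.good_def by (blast elim: B.M_cases)
  obtain \<xi>1 where \<xi>1: "X1 = B.cls \<xi>1" using good_X1 unfolding B.good_def by (blast elim: B.M_cases)
  have cut: "B.cls (\<lambda>z. vset {b \<in> elts (a z). Q z (x z) b}) = vset {b \<in> elts (B.cls a). \<not> fs_less (B.cls x) b}"
    if x: "B.cls x \<in> elts X0" and a: "elts (B.cls a) \<subseteq> elts X1" for x a
  proof (rule extensionality)
    have "elts (B.cls (\<lambda>z. vset {b \<in> elts (a z). Q z (x z) b})) = {b \<in> elts (B.cls a). \<not> fs_less (B.cls x) b}"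
    proof (rule B.cls_Collect)
      fix f assume "B.cls f \<in> elts (B.cls a)"
      then have "B.cls f \<in> elts X1" using a by blast
      then show "eventually (\<lambda>z. Q z (x z) (f z)) B.F \<longleftrightarrow> \<not> fs_less (B.cls x) (B.cls f)"
        using Q [OF x] by blast
    qed
    then show "elts (B.cls (\<lambda>z. vset {b \<in> elts (a z). Q z (x z) b}))
        = elts (vset {b \<in> elts (B.cls a). \<not> fs_less (B.cls x) b})" by simp
  qed
  have large: "B.cls (\<lambda>z. vset {x \<in> elts (\<xi>0 z). P z x (vset {b \<in> elts (a z). Q z x b})})
      = vset {x \<in> elts X0. \<Phi> x (vset {b \<in> elts (B.cls a). \<not> fs_less x b})}"
    if a: "elts (B.cls a) \<subseteq> elts X1" for a
  proof (rule extensionality)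
    have "elts (B.cls (\<lambda>z. vset {x \<in> elts (\<xi>0 z). P z x (vset {b \<in> elts (a z). Q z x b})}))
      = {x \<in> elts (B.cls \<xi>0). \<Phi> x (vset {b \<in> elts (B.cls a). \<not> fs_less x b})}"
    proof (rule B.cls_Collect)
      fix x assume "B.cls x \<in> elts (B.cls \<xi>0)"
      then have x: "B.cls x \<in> elts X0" by (simp add: \<xi>0)
      have "B.cls (\<lambda>z. vset {b \<in> elts (a z). Q z (x z) b}) \<in> elts E"
        unfolding cut [OF x a] E using x a D by auto
      then show "eventually (\<lambda>z. P z (x z) (vset {b \<in> elts (a z). Q z (x z) b})) B.F \<longleftrightarrow>
          \<Phi> (B.cls x) (vset {b \<in> elts (B.cls a). \<not> fs_less (B.cls x) b})"
        using P [OF x, of "\<lambda>z. vset {b \<in> elts (a z). Q z (x z) b}"] unfolding cut [OF x a] by blast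
    qed
    then show "elts (B.cls (\<lambda>z. vset {x \<in> elts (\<xi>0 z). P z x (vset {b \<in> elts (a z). Q z x b})}))
      = elts (vset {x \<in> elts X0. \<Phi> x (vset {b \<in> elts (B.cls a). \<not> fs_less x b})})" by (simp add: \<xi>0)
  qed
  \<comment> \<open>The fibrewise definition of \<open>U1\<close>: \<open>lim\<close> with
    \<open>\<Phi>\<close>, \<open>fs_less\<close> and \<open>U0\<close> replaced by their
    representations \<open>P\<close>, \<open>Q\<close> and \<open>u\<close>.\<close>
  let ?V = "\<lambda>z. vset {A \<in> elts (vpow (\<xi>1 z)). vset {x \<in> elts (\<xi>0 z). P z x (vset {b \<in> elts A. Q z x b})} \<in> elts (u z)}"
  have U1_sub: "elts A \<subseteq> elts X1" if "A \<in> elts U1" for A using that X unfolding B.mem_U_iff by simp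
  have "elts (B.cls ?V) = elts U1"
  proof (rule B.elts_cls_eqI)
    fix a
    have sub: "eventually (\<lambda>z. elts (a z) \<subseteq> elts (\<xi>1 z)) B.F \<longleftrightarrow> elts (B.cls a) \<subseteq> elts X1"
      by (simp add: \<xi>1 B.cls_subset_iff)
    have "eventually (\<lambda>z. vset {x \<in> elts (\<xi>0 z). P z x (vset {b \<in> elts (a z). Q z x b})} \<in> elts (u z)) B.F
        \<longleftrightarrow> B.cls a \<in> elts U1" if a: "elts (B.cls a) \<subseteq> elts X1"
    proof -
      have "eventually (\<lambda>z. vset {x \<in> elts (\<xi>0 z). P z x (vset {b \<in> elts (a z). Q z x b})} \<in> elts (u z)) B.F
        \<longleftrightarrow> vset {x \<in> elts X0. \<Phi> x (vset {b \<in> elts (B.cls a). \<not> fs_less x b})} \<in> elts U0"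
        unfolding u B.cls_mem_iff [symmetric] large [OF a] ..
      also have "\<dots> \<longleftrightarrow> B.cls a \<in> elts U1"
        using lim [of "B.cls a"] a unfolding A.eventually_F X by blast
      finally show ?thesis .
    qed
    moreover have "a z \<in> elts (?V z) \<longleftrightarrow> elts (a z) \<subseteq> elts (\<xi>1 z) \<and>
        vset {x \<in> elts (\<xi>0 z). P z x (vset {b \<in> elts (a z). Q z x b})} \<in> elts (u z)" for z
      by (subst elts_vset [OF small_Collect]) simp
    ultimately show "eventually (\<lambda>z. a z \<in> elts (?V z)) B.F \<longleftrightarrow> B.cls a \<in> elts U1"
      unfolding eventually_conj_iff sub using U1_sub [of "B.cls a"] by (auto simp only: eventually_conj_iff sub)
  next
    show "elts U1 \<subseteq> B.M" using U1_sub B.good_Pow [OF good_X1] by blast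
  qed
  then have "B.cls ?V = U1" by (rule extensionality)
  then have "U1 \<in> B.M" by (rule subst) (rule B.cls_in_M)
  moreover have "U1 \<notin> B.M"
  proof (rule B.Mitchell_irreflexive [OF np])
    \<comment> \<open>Elements of \<open>X1\<close> are subsets of \<open>\<kappa>1\<close>, so
      adding \<open>\<kappa>1\<close> makes the set transitive while it stays good.\<close>
    let ?T = "vset (elts X1 \<union> elts \<kappa>1)"
    have T: "elts ?T = elts X1 \<union> elts \<kappa>1" by simp
    show "y \<in> elts ?T" if "x \<in> elts ?T" "y \<in> elts x" for x y
      using that X1E Ord_trans [OF ord(2)] unfolding T by blast
    show "elts B.X \<subseteq> elts ?T" unfolding X T by blast
    show "vlam B.X h \<in> B.M" if "\<And>x. x \<in> elts B.X \<Longrightarrow> h x \<in> elts ?T" for h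
      unfolding X
    proof (rule B.vlam_in_M)
      have "B.good ?T" using good_X1 good_\<kappa>1 by (rule B.good_Un)
      then show "?T \<in> B.M" "B.all_internal (elts X1) (elts ?T)"
        using B.good_all_internal [OF good_X1 _ X1\<theta>] unfolding B.good_def by blast+
      show "X1 \<in> B.M" using good_X1 unfolding B.good_def by blast
      show "h y \<in> elts ?T" if "y \<in> elts X1" for y using that \<open>\<And>x. x \<in> elts B.X \<Longrightarrow> h x \<in> elts ?T\<close> X by simp
    qed
  qed
  ultimately show False by blast
qed

theorem theorem5p12:
  fixes U0 U1 :: "'v::zfc"
  assumes "Ultrapower_Axiom TYPE('v)"
    and "uniform_ultrafilter U0"
    and "uniform_ultrafilter U1" and "nonprincipal U1"
    and "U0 \<in> Ult UNIV U1"
    and "elts (vpow (two_pow_less (sp U0))) \<subseteq> Ult UNIV U1"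
  shows "U0 <\<^sub>S U1"
proof (rule ccontr)
  assume not_less: "\<not> U0 <\<^sub>S U1"
  obtain \<kappa>0 n0 \<kappa>1 n1 where U: "uniform_on U0 \<kappa>0 n0" "uniform_on U1 \<kappa>1 n1"
    using assms(2,3) unfolding uniform_ultrafilter_def by blast
  then have cc: "cc_ultrafilter UNIV U0" "cc_ultrafilter UNIV U1"
    unfolding uniform_on_def cc_ultrafilter_def by blast+
  then obtain W0 W1 where comp: "comparison U0 U1 W0 W1"
    using assms(1) unfolding Ultrapower_Axiom_def by blast
  \<comment> \<open>The seed order asks for some comparison with the inequality, so its failure
    gives the negation for the comparison at hand.\<close>
  then have "\<not> fs_less (ult_emb (Ult UNIV U0) W0 (ult_id UNIV U0)) (ult_emb (Ult UNIV U1) W1 (ult_id UNIV U1))"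
    using not_less unfolding seed_less_def by blast
  with cc comp obtain \<Phi> where "\<forall>A. elts A \<subseteq> elts (base U1) \<longrightarrow>
      (A \<in> elts U1 \<longleftrightarrow> eventually (\<lambda>x. \<Phi> x (vset {b \<in> elts A. \<not> fs_less x b})) (ult_filter U0))"
    by (rule comparison_limit)
  then show False
    using bounded_limit_false [OF U assms(4,5) assms(6) [unfolded sp_eq [OF U(1)]], of \<Phi>] by blast
qed

end
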